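(* There exists a minimizer for the problem \[ \min\Big\{ T_2(\Omega)^{\frac{1}{N+2}}\,h_1(\Omega) \;:\; \Omega\subset\mathbb{R}^N \text{ open, convex, bounded}\Big\}. \] That is, there is an open, bounded, convex set $\Omega^*\subset\mathbb{R}^N$ such that $T_2(\Omega^* )^{\frac{1}{N+2}}h_1(\Omega^* )\le T_2(\Omega)^{\frac{1}{N+2}}h_1(\Omega)$ for every open, bounded, convex set $\Omega\subset\mathbb{R}^N$.
   Context: Sets are tacitly non-empty. For an open bounded set $\Omega\subset\mathbb{R}^N$: The ($2$-)torsional rigidity is \[ T_2(\Omega)=\sup\left\{\frac{\left(\int_\Omega |u|\,dx\right)^2}{\int_\Omega|\nabla u|^2\,dx} : u\in W^{1,2}_0(\Omega)\setminus\{0\}\right\}. \] The Cheeger constant is \[ h_1(\Omega)=\inf\left\{\frac{P(E)}{|E|}: E\subset\overline{\Omega}\right\}, \] the infimum being over Borel sets $E$ with $|E|>0$, where $|\cdot|$ is Lebesgue measure and $P(E)=\sup\{\int_E \nabla\cdot\phi\,dx : \phi\in C^1_c(\mathbb{R}^N,\mathbb{R}^N),\ \|\phi\|_\infty\le 1\}$ is the Caccioppoli--De Giorgi perimeter. *)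

theory Defs
  imports "HOL-Analysis.Analysis"
begin

primrec Ck :: "nat \<Rightarrow> ('a::euclidean_space \<Rightarrow> 'b::real_normed_vector) \<Rightarrow> bool" where
  "Ck 0 f \<longleftrightarrow> continuous_on UNIV f"
| "Ck (Suc k) f \<longleftrightarrow> (\<forall>x. f differentiable (at x)) \<and>
     (\<forall>b\<in>Basis. Ck k (\<lambda>x. frechet_derivative f (at x) b))"

definition support :: "('a::euclidean_space \<Rightarrow> 'b::real_normed_vector) \<Rightarrow> 'a set" where
  "support f = closure {x. f x \<noteq> 0}"

text \<open>\<open>test_functions \<Omega>\<close> is the space of smooth functions with compact support in \<open>\<Omega>\<close>,
  extended by zero to the whole space.\<close>

definition test_functions :: "'a::euclidean_space set \<Rightarrow> ('a \<Rightarrow> real) set" where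
  "test_functions \<Omega> = {\<phi>. (\<forall>k. Ck k \<phi>) \<and> compact (support \<phi>) \<and> support \<phi> \<subseteq> \<Omega>}"

definition grad :: "('a::euclidean_space \<Rightarrow> real) \<Rightarrow> 'a \<Rightarrow> 'a" where
  "grad \<phi> x = (\<Sum>b\<in>Basis. frechet_derivative \<phi> (at x) b *\<^sub>R b)"

definition divergence :: "('a::euclidean_space \<Rightarrow> 'a) \<Rightarrow> 'a \<Rightarrow> real" where
  "divergence \<phi> x = (\<Sum>b\<in>Basis. frechet_derivative \<phi> (at x) b \<bullet> b)"

definition L2 :: "'a::euclidean_space set \<Rightarrow> ('a \<Rightarrow> 'b::euclidean_space) \<Rightarrow> bool" where
  "L2 \<Omega> f \<longleftrightarrow> f \<in> borel_measurable (lebesgue_on \<Omega>) \<and>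
     integrable (lebesgue_on \<Omega>) (\<lambda>x. (norm (f x))\<^sup>2)"

text \<open>Sobolev functions are represented by functions rather than by classes modulo null sets,
  and paired with a representative of their (almost everywhere unique) weak gradient:
  \<open>W12 \<Omega> u g\<close> says that \<open>u\<close> lies in \<open>W\<^sup>1\<^sup>,\<^sup>2(\<Omega>)\<close> with weak gradient \<open>g\<close>,
  and \<open>W12_0 \<Omega> u g\<close> that moreover \<open>u\<close> lies in the closure of the test functions
  with respect to the \<open>W\<^sup>1\<^sup>,\<^sup>2\<close> norm.\<close>

definition W12 :: "'a::euclidean_space set \<Rightarrow> ('a \<Rightarrow> real) \<Rightarrow> ('a \<Rightarrow> 'a) \<Rightarrow> bool" where
  "W12 \<Omega> u g \<longleftrightarrow> L2 \<Omega> u \<and> L2 \<Omega> g \<and>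
     (\<forall>\<phi>\<in>test_functions \<Omega>. \<forall>b\<in>Basis.
        (\<integral>x. u x * frechet_derivative \<phi> (at x) b \<partial>lebesgue_on \<Omega>)
          = - (\<integral>x. (g x \<bullet> b) * \<phi> x \<partial>lebesgue_on \<Omega>))"

definition W12_0 :: "'a::euclidean_space set \<Rightarrow> ('a \<Rightarrow> real) \<Rightarrow> ('a \<Rightarrow> 'a) \<Rightarrow> bool" where
  "W12_0 \<Omega> u g \<longleftrightarrow> W12 \<Omega> u g \<and>
     (\<exists>\<phi>. (\<forall>n. \<phi> n \<in> test_functions \<Omega>) \<and>
        (\<lambda>n. \<integral>x. (\<phi> n x - u x)\<^sup>2 + (norm (grad (\<phi> n) x - g x))\<^sup>2 \<partial>lebesgue_on \<Omega>)
          \<longlonglongrightarrow> 0)"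

definition torsional_rigidity :: "'a::euclidean_space set \<Rightarrow> ennreal" where
  "torsional_rigidity \<Omega> =
     Sup {(\<integral>\<^sup>+x. ennreal \<bar>u x\<bar> \<partial>lebesgue_on \<Omega>)\<^sup>2 /
          (\<integral>\<^sup>+x. ennreal ((norm (g x))\<^sup>2) \<partial>lebesgue_on \<Omega>) | u g.
          W12_0 \<Omega> u g \<and> \<not> (AE x in lebesgue_on \<Omega>. u x = 0)}"

text \<open>In \<open>perimeter\<close>, the truncation of negative integrals to \<open>0\<close> by \<open>ennreal\<close> does not change
  the supremum, because the field \<open>\<phi> = 0\<close> is admissible.\<close>

definition perimeter :: "'a::euclidean_space set \<Rightarrow> ennreal" where
  "perimeter E =
     Sup {ennreal (\<integral>x. divergence \<phi> x \<partial>lebesgue_on E) | \<phi>.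
          Ck 1 \<phi> \<and> compact (support \<phi>) \<and> (\<forall>x. norm (\<phi> x) \<le> 1)}"

definition cheeger_constant :: "'a::euclidean_space set \<Rightarrow> ennreal" where
  "cheeger_constant \<Omega> =
     Inf {perimeter E / emeasure lebesgue E | E.
          E \<in> sets borel \<and> E \<subseteq> closure \<Omega> \<and> emeasure lebesgue E > 0}"

text \<open>Extension of \<open>x powr a\<close> to \<open>[0, \<infinity>]\<close>, meant for exponents \<open>a > 0\<close> only.\<close>

definition ennreal_powr :: "ennreal \<Rightarrow> real \<Rightarrow> ennreal" where
  "ennreal_powr x a = (if x = \<infinity> then \<infinity> else ennreal (enn2real x powr a))"

definition torsion_cheeger :: "(real ^ 'n) set \<Rightarrow> ennreal" where
  "torsion_cheeger \<Omega> =
     ennreal_powr (torsional_rigidity \<Omega>) (1 / (real CARD('n) + 2)) * cheeger_constant \<Omega>"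

end

theory Submission
  imports Defs "HOL-Complex_Analysis.Great_Picard"
begin

text \<open>Write \<open>F = T powr (1 / (N + 2)) * h\<close> for the functional. The proof is the direct method, in a form that avoids
  any lower semicontinuity theorem.

  The rigidity \<open>T\<close> increases with the set and is homogeneous of degree \<open>N + 2\<close>, the Cheeger constant \<open>h\<close>
  decreases with the set and is homogeneous of degree \<open>-1\<close>. Hence \<open>F\<close> is invariant
  under similarities, and \<open>L \<subseteq> (1 + e) \<Omega>\<close> together with \<open>\<Omega> \<subseteq> (1 + e) L\<close> gives
  \<open>F(L) \<le> (1 + e)\<^sup>2 F(\<Omega>)\<close> (\<open>torsion_cheeger_le_of_subsets\<close>). So it is enough to find a minimizing sequence
  that converges in the sense of such inclusions, which by Arzela and Ascoli is possible if all its members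
  lie between two fixed concentric balls (\<open>convex_body_selection\<close>).

  The remaining point is that a minimizing sequence does not degenerate. A convex set with inradius
  comparable to \<open>1\<close> lies in a slab of width bounded in terms of \<open>N\<close>, because a simplex of
  maximal volume in it, with one vertex prescribed, controls the whole set (\<open>inball_and_slab\<close>). A vector field across the slab shows that
  its Cheeger constant is bounded below (\<open>cheeger_ge_of_slab\<close>). If its diameter is \<open>d\<close>, it contains a number
  of disjoint balls of fixed radius proportional to \<open>d\<close>, and the rigidity is superadditive on disjoint
  sets, so \<open>T\<close> is at least a multiple of \<open>d\<close> (\<open>torsion_ge_of_disjoint_balls\<close>). Therefore \<open>F\<close> is
  at least a multiple of \<open>d powr (1 / (N + 2))\<close>, and a bound on \<open>F\<close> bounds the diameter
  (\<open>normalized_competitor\<close>).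

  All statements about the rigidity are reduced to test functions. From below this requires that a test
  function belongs to \<open>W\<^sub>0\<^sup>1\<^sup>,\<^sup>2\<close> with its classical gradient (\<open>test_function_W12_0\<close>), from above a limit passage
  (\<open>torsion_bound_of_test_functions\<close>).\<close>

section \<open>Smooth functions and a bump\<close>

lemma frechet_derivative_eqI:
  "(f has_derivative D) (at x) \<Longrightarrow> frechet_derivative f (at x) = D"
  by (metis frechet_derivative_at)

text \<open>A class of functions that contains the directional derivatives of its members consists of smooth
  functions, since the derivatives can be iterated. This avoids product and chain rules for \<open>Ck k\<close>.\<close>

lemma Ck_of_closed_class:
  assumes S: "\<And>f. f \<in> S \<Longrightarrow> \<exists>D. (\<forall>x. (f has_derivative D x) (at x)) \<and> (\<forall>b. (\<lambda>x. D x b) \<in> S)"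
    and "f \<in> S"
  shows "Ck k f"
  using \<open>f \<in> S\<close>
proof (induction k arbitrary: f)
  case 0
  then show ?case
    using S[OF 0] by (auto simp: continuous_on_eq_continuous_at intro: has_derivative_continuous)
next
  case (Suc k)
  obtain D where D: "\<And>x. (f has_derivative D x) (at x)" "\<And>b. (\<lambda>x. D x b) \<in> S"
    using S[OF Suc.prems] by auto
  have "frechet_derivative f (at x) = D x" for x
    using D(1) by (rule frechet_derivative_eqI)
  then show ?case
    using D Suc.IH by (auto simp: differentiable_def)
qed

lemma has_derivative_frechet: "f differentiable (at x) \<Longrightarrow> (f has_derivative frechet_derivative f (at x)) (at x)"
  by (simp add: frechet_derivative_works)

lemma has_derivative_affine_comp:
  fixes f :: "'a::euclidean_space \<Rightarrow> 'b::real_normed_vector"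
  assumes "(f has_derivative D) (at (a + t *\<^sub>R x))"
  shows "((\<lambda>x. c *\<^sub>R f (a + t *\<^sub>R x)) has_derivative (\<lambda>h. (c * t) *\<^sub>R D h)) (at x)"
proof -
  interpret bounded_linear D using assms by (rule has_derivative_bounded_linear)
  have "((\<lambda>x. a + t *\<^sub>R x) has_derivative (\<lambda>h. t *\<^sub>R h)) (at x)"
    by (auto intro!: derivative_eq_intros)
  from has_derivative_compose[OF this assms]
  have "((\<lambda>x. f (a + t *\<^sub>R x)) has_derivative (\<lambda>h. D (t *\<^sub>R h))) (at x)" .
  then show ?thesis
    using has_derivative_scaleR_right[of _ "\<lambda>h. D (t *\<^sub>R h)" "at x" c] by (simp add: scaleR)
qed

text \<open>The factor \<open>c\<close> makes the induction go through, because each derivative of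
  \<open>x \<mapsto> f (a + t x)\<close> picks up a further factor \<open>t\<close>.\<close>

lemma Ck_affine_comp:
  fixes f :: "'a::euclidean_space \<Rightarrow> 'b::real_normed_vector"
  shows "Ck k f \<Longrightarrow> Ck k (\<lambda>x. c *\<^sub>R f (a + t *\<^sub>R x))"
proof (induction k arbitrary: f c)
  case 0
  then have "continuous_on UNIV f" by simp
  then show ?case
    by (auto intro!: continuous_intros continuous_on_compose2[of UNIV f])
next
  case (Suc k)
  have D: "((\<lambda>x. c *\<^sub>R f (a + t *\<^sub>R x)) has_derivative
      (\<lambda>h. (c * t) *\<^sub>R frechet_derivative f (at (a + t *\<^sub>R x)) h)) (at x)" for x
    by (intro has_derivative_affine_comp has_derivative_frechet) (use Suc.prems in auto)
  have "frechet_derivative (\<lambda>x. c *\<^sub>R f (a + t *\<^sub>R x)) (at x)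
      = (\<lambda>h. (c * t) *\<^sub>R frechet_derivative f (at (a + t *\<^sub>R x)) h)" for x
    using D by (rule frechet_derivative_eqI)
  moreover have "Ck k (\<lambda>x. (c * t) *\<^sub>R frechet_derivative f (at (a + t *\<^sub>R x)) b)" if "b \<in> Basis" for b
    by (rule Suc.IH[of "\<lambda>y. frechet_derivative f (at y) b"]) (use Suc.prems that in auto)
  ultimately show ?case
    using D by (auto simp: differentiable_def)
qed

lemma Ck_1_scaleR_const:
  fixes f :: "'a::euclidean_space \<Rightarrow> real"
  assumes "Ck (Suc 0) f"
  shows "Ck (Suc 0) (\<lambda>x. f x *\<^sub>R v)"
proof -
  have D: "((\<lambda>x. f x *\<^sub>R v) has_derivative (\<lambda>h. frechet_derivative f (at x) h *\<^sub>R v)) (at x)" for x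
    by (intro has_derivative_scaleR_left has_derivative_frechet) (use assms in auto)
  have "frechet_derivative (\<lambda>x. f x *\<^sub>R v) (at x) = (\<lambda>h. frechet_derivative f (at x) h *\<^sub>R v)" for x
    using D by (rule frechet_derivative_eqI)
  then show ?thesis
    using D assms by (auto simp: differentiable_def intro!: continuous_intros)
qed

text \<open>The functions \<open>p (1 / s) exp (- 1 / s)\<close>, extended by zero to \<open>s \<le> 0\<close>. With a polynomial factor
  allowed, the family is closed under differentiation, which makes the standard flat function
  \<open>exp (- 1 / s)\<close> infinitely differentiable without any estimate on its higher derivatives.\<close>

definition flat :: "real poly \<Rightarrow> real \<Rightarrow> real" where
  "flat p s = (if s > 0 then poly p (1 / s) * exp (- (1 / s)) else 0)"

lemma poly_times_exp_minus_tendsto_0: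
  "((\<lambda>t::real. poly p t * exp (- t)) \<longlongrightarrow> 0) at_top"
proof -
  have "((\<lambda>t::real. \<Sum>i\<le>degree p. coeff p i * (t ^ i / exp t)) \<longlongrightarrow> (\<Sum>i\<le>degree p. coeff p i * 0)) at_top"
    by (intro tendsto_intros tendsto_power_div_exp_0)
  then show ?thesis
    by (simp add: poly_altdef sum_distrib_right sum_divide_distrib exp_minus field_simps)
qed

text \<open>The only point where differentiability of \<open>flat\<close> is in doubt is \<open>0\<close>. On the right, the substitution
  \<open>t = 1 / s\<close> turns the quotient into a polynomial times \<open>exp (- t)\<close>.\<close>

lemma flat_quotient_tendsto_0: "((\<lambda>s. flat p s / s) \<longlongrightarrow> 0) (at 0)"
proof -
  have right: "((\<lambda>s. flat p s / s) \<longlongrightarrow> 0) (at_right 0)"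
  proof -
    have "((\<lambda>s. poly (pCons 0 p) (inverse s) * exp (- inverse s)) \<longlongrightarrow> 0) (at_right (0::real))"
      by (rule filterlim_compose[OF poly_times_exp_minus_tendsto_0 filterlim_inverse_at_top_right])
    then show ?thesis
      by (rule Lim_transform_eventually)
        (auto simp: eventually_at_right_less flat_def divide_simps eventually_at intro!: exI[of _ 1])
  qed
  have left: "((\<lambda>s. flat p s / s) \<longlongrightarrow> 0) (at_left 0)"
    by (rule tendsto_eventually) (auto simp: flat_def eventually_at intro!: exI[of _ 1])
  show ?thesis
    using left right filterlim_split_at by blast
qed

lemma flat_has_real_derivative:
  "(flat p has_real_derivative flat ([:0, 0, 1:] * (p - pderiv p)) s) (at s)"
proof (cases s "0::real" rule: linorder_cases)
  case less
  have "((\<lambda>_. 0) has_real_derivative 0) (at s)" by simp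
  then have "(flat p has_real_derivative 0) (at s)"
    by (rule has_field_derivative_transform_within_open[where S="{..<0}"]) (use less in \<open>auto simp: flat_def\<close>)
  then show ?thesis using less by (simp add: flat_def)
next
  case equal
  have "(flat p has_real_derivative 0) (at 0)"
    using flat_quotient_tendsto_0[of p] by (simp add: has_field_derivative_iff flat_def)
  then show ?thesis using equal by (simp add: flat_def)
next
  case greater
  have "((\<lambda>s. poly p (1 / s) * exp (- (1 / s))) has_real_derivative
      poly ([:0, 0, 1:] * (p - pderiv p)) (1 / s) * exp (- (1 / s))) (at s)"
    using greater by (auto intro!: derivative_eq_intros DERIV_chain'[OF _ poly_DERIV] simp: field_simps power2_eq_square)
  then have "(flat p has_real_derivative
      poly ([:0, 0, 1:] * (p - pderiv p)) (1 / s) * exp (- (1 / s))) (at s)"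
    by (rule has_field_derivative_transform_within_open[where S="{0<..}"]) (use greater in \<open>auto simp: flat_def\<close>)
  then show ?thesis using greater by (simp add: flat_def)
qed

text \<open>The smooth functions needed below are built from these operations. Sine and cosine enter only
  through the vector field that bounds the Cheeger constant.\<close>

inductive_set smooth_fns :: "('a::euclidean_space \<Rightarrow> real) set" where
  const: "(\<lambda>x. c) \<in> smooth_fns"
| inner: "(\<lambda>x. x \<bullet> v) \<in> smooth_fns"
| add: "f \<in> smooth_fns \<Longrightarrow> g \<in> smooth_fns \<Longrightarrow> (\<lambda>x. f x + g x) \<in> smooth_fns"
| mult: "f \<in> smooth_fns \<Longrightarrow> g \<in> smooth_fns \<Longrightarrow> (\<lambda>x. f x * g x) \<in> smooth_fns"
| flat: "f \<in> smooth_fns \<Longrightarrow> (\<lambda>x. flat p (f x)) \<in> smooth_fns"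
| sin: "f \<in> smooth_fns \<Longrightarrow> (\<lambda>x. sin (f x)) \<in> smooth_fns"
| cos: "f \<in> smooth_fns \<Longrightarrow> (\<lambda>x. cos (f x)) \<in> smooth_fns"

text \<open>The closure property asked for by \<open>Ck_of_closed_class\<close>: by the sum, product and chain rules, each
  constructor has a derivative built from the same constructors.\<close>

lemma smooth_fns_derivative:
  "f \<in> smooth_fns \<Longrightarrow> \<exists>D. (\<forall>x. (f has_derivative D x) (at x)) \<and> (\<forall>b. (\<lambda>x. D x b) \<in> smooth_fns)"
proof (induction rule: smooth_fns.induct)
  case (const c)
  then show ?case by (intro exI[of _ "\<lambda>x h. 0"]) (auto intro: smooth_fns.intros)
next
  case (inner v)
  have "((\<lambda>x. x \<bullet> v) has_derivative (\<lambda>h. h \<bullet> v)) (at x)" for x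
    by (auto intro!: derivative_eq_intros)
  then show ?case by (intro exI[of _ "\<lambda>x h. h \<bullet> v"]) (auto intro: smooth_fns.intros)
next
  case (add f g)
  then obtain D E where "\<And>x. (f has_derivative D x) (at x)" "\<And>b. (\<lambda>x. D x b) \<in> smooth_fns"
    "\<And>x. (g has_derivative E x) (at x)" "\<And>b. (\<lambda>x. E x b) \<in> smooth_fns" by auto
  then show ?case
    by (intro exI[of _ "\<lambda>x h. D x h + E x h"])
      (auto intro!: smooth_fns.intros has_derivative_add)
next
  case (mult f g)
  then obtain D E where *: "\<And>x. (f has_derivative D x) (at x)" "\<And>b. (\<lambda>x. D x b) \<in> smooth_fns"
    "\<And>x. (g has_derivative E x) (at x)" "\<And>b. (\<lambda>x. E x b) \<in> smooth_fns" by auto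
  then show ?case using mult
    by (intro exI[of _ "\<lambda>x h. f x * E x h + D x h * g x"])
      (auto intro!: smooth_fns.intros has_derivative_mult)
next
  case (flat f p)
  let ?q = "[:0, 0, 1:] * (p - pderiv p)"
  from flat obtain D where *: "\<And>x. (f has_derivative D x) (at x)" "\<And>b. (\<lambda>x. D x b) \<in> smooth_fns" by auto
  have "((\<lambda>x. flat p (f x)) has_derivative (\<lambda>h. flat ?q (f x) * D x h)) (at x)" for x
    using has_derivative_compose[OF *(1) flat_has_real_derivative[unfolded has_field_derivative_def]] .
  then show ?case using flat *
    by (intro exI[of _ "\<lambda>x h. flat ?q (f x) * D x h"])
      (auto intro!: smooth_fns.mult smooth_fns.flat simp del: mult_pCons_left)
next
  case (sin f)
  from sin obtain D where *: "\<And>x. (f has_derivative D x) (at x)" "\<And>b. (\<lambda>x. D x b) \<in> smooth_fns" by auto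
  have "((\<lambda>x. sin (f x)) has_derivative (\<lambda>h. cos (f x) * D x h)) (at x)" for x
    using has_derivative_compose[OF *(1) DERIV_sin[unfolded has_field_derivative_def]] .
  then show ?case using sin *
    by (intro exI[of _ "\<lambda>x h. cos (f x) * D x h"]) (auto intro!: smooth_fns.intros)
next
  case (cos f)
  from cos obtain D where *: "\<And>x. (f has_derivative D x) (at x)" "\<And>b. (\<lambda>x. D x b) \<in> smooth_fns" by auto
  have "((\<lambda>x. cos (f x)) has_derivative (\<lambda>h. - sin (f x) * D x h)) (at x)" for x
    using has_derivative_compose[OF *(1) DERIV_cos[unfolded has_field_derivative_def]] .
  moreover have "(\<lambda>x. - sin (f x) * D x b) \<in> smooth_fns" for b
    using smooth_fns.mult[OF smooth_fns.mult[OF smooth_fns.const[of "-1"] smooth_fns.sin[OF cos.hyps]] *(2)] by simp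
  ultimately show ?case
    by (intro exI[of _ "\<lambda>x h. - sin (f x) * D x h"]) auto
qed

lemma smooth_fns_Ck: "f \<in> smooth_fns \<Longrightarrow> Ck k f"
  by (rule Ck_of_closed_class[OF smooth_fns_derivative])

lemma smooth_fns_inner_self: "(\<lambda>x::'a::euclidean_space. x \<bullet> x) \<in> smooth_fns"
proof -
  have sum: "finite A \<Longrightarrow> (\<lambda>x::'a. \<Sum>b\<in>A. (x \<bullet> b) * (x \<bullet> b)) \<in> smooth_fns" for A
    by (induction rule: finite_induct) (auto intro!: smooth_fns.intros)
  have eq: "(\<lambda>x::'a. x \<bullet> x) = (\<lambda>x. \<Sum>b\<in>Basis. (x \<bullet> b) * (x \<bullet> b))"
    by (rule ext, rule euclidean_inner)
  show ?thesis unfolding eq by (intro sum finite_Basis)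
qed

lemma smooth_fns_sum: "finite A \<Longrightarrow> (\<And>i. i \<in> A \<Longrightarrow> f i \<in> smooth_fns) \<Longrightarrow> (\<lambda>x. \<Sum>i\<in>A. f i x) \<in> smooth_fns"
  by (induction rule: finite_induct) (auto intro!: smooth_fns.intros)

definition bump :: "'a::euclidean_space \<Rightarrow> real" where
  "bump x = flat 1 (1 - x \<bullet> x)"

lemma smooth_fns_bump_affine: "(\<lambda>x::'a::euclidean_space. bump (r *\<^sub>R (x - a))) \<in> smooth_fns"
proof -
  have "(\<lambda>x::'a. flat 1 ((1 + - (r^2) * (a \<bullet> a)) + (x \<bullet> ((2 * r^2) *\<^sub>R a) + - (r^2) * (x \<bullet> x)))) \<in> smooth_fns"
    by (intro smooth_fns.intros smooth_fns_inner_self)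
  moreover have "bump (r *\<^sub>R (x - a)) = flat 1 ((1 + - (r^2) * (a \<bullet> a)) + (x \<bullet> ((2 * r^2) *\<^sub>R a) + - (r^2) * (x \<bullet> x)))" for x
    unfolding bump_def by (rule arg_cong[where f="flat 1"])
      (simp add: inner_diff_left inner_diff_right inner_commute algebra_simps power2_eq_square)
  ultimately show ?thesis by presburger
qed

lemma bump_nonneg: "0 \<le> bump x" and bump_le_1: "bump x \<le> 1"
  by (auto simp: bump_def flat_def)

lemma bump_nonzero_iff: "bump x \<noteq> 0 \<longleftrightarrow> norm x < 1"
proof -
  have "0 < 1 - x \<bullet> x \<longleftrightarrow> norm x < 1"
    using power_less_one_iff[of "norm x" 2] by (auto simp: power2_norm_eq_inner[symmetric] )
  then show ?thesis by (auto simp: bump_def flat_def)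
qed

section \<open>Test functions and integration by parts\<close>

lemma not_in_support: "x \<notin> support f \<Longrightarrow> f x = 0"
  using closure_subset[of "{x. f x \<noteq> 0}"] by (auto simp: support_def)

lemma has_derivative_zero_off_support:
  assumes "x \<notin> support f"
  shows "(f has_derivative (\<lambda>_. 0)) (at x)"
proof (rule has_derivative_transform_within_open[where f="\<lambda>_. 0" and s="- support f"])
  show "open (- support f)" by (simp add: support_def open_Compl)
  show "0 = f y" if "y \<in> - support f" for y
    using not_in_support[of y f] that by simp
qed (use assms in simp_all)

lemma frechet_derivative_off_support:
  "x \<notin> support f \<Longrightarrow> frechet_derivative f (at x) = (\<lambda>_. 0)"
  by (rule frechet_derivative_eqI[OF has_derivative_zero_off_support])

lemma grad_off_support: "x \<notin> support f \<Longrightarrow> grad f x = 0"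
  by (simp add: grad_def frechet_derivative_off_support)

lemma divergence_off_support: "x \<notin> support f \<Longrightarrow> divergence f x = 0"
  by (simp add: divergence_def frechet_derivative_off_support)

lemma Ck_1_continuous_derivative:
  "Ck (Suc 0) f \<Longrightarrow> b \<in> Basis \<Longrightarrow> continuous_on UNIV (\<lambda>x. frechet_derivative f (at x) b)"
  by simp

lemma Ck_1_continuous: "Ck (Suc 0) f \<Longrightarrow> continuous_on UNIV f"
  by (auto simp: continuous_on_eq_continuous_at differentiable_imp_continuous_within)

lemma continuous_on_grad: "Ck (Suc 0) f \<Longrightarrow> continuous_on UNIV (grad f)"
  unfolding grad_def by (intro continuous_intros Ck_1_continuous_derivative)

lemma continuous_on_divergence: "Ck (Suc 0) f \<Longrightarrow> continuous_on UNIV (divergence f)"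
  unfolding divergence_def by (intro continuous_intros Ck_1_continuous_derivative)

lemma integrable_lborel_compact_support:
  fixes f :: "'a::euclidean_space \<Rightarrow> 'b::{banach, second_countable_topology}"
  assumes "continuous_on UNIV f" "compact K" "\<And>x. x \<notin> K \<Longrightarrow> f x = 0"
  shows "integrable lborel f"
proof -
  have "integrable lborel (\<lambda>x. indicator K x *\<^sub>R f x)"
    by (intro borel_integrable_compact continuous_on_subset[OF assms(1)] assms) auto
  moreover have "(\<lambda>x. indicator K x *\<^sub>R f x) = f"
    using assms(3) by (auto simp: indicator_def)
  ultimately show ?thesis by simp
qed

lemma
  fixes f :: "'a::euclidean_space \<Rightarrow> real" and c :: real and t :: 'a
  assumes c: "c \<noteq> 0" and f: "integrable lborel f"
  shows integrable_lborel_affine: "integrable lborel (\<lambda>x. f (t + c *\<^sub>R x))"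
    and integral_lborel_affine: "(\<integral>x. f x \<partial>lborel) = \<bar>c\<bar> ^ DIM('a) * (\<integral>x. f (t + c *\<^sub>R x) \<partial>lborel)"
proof -
  have [measurable]: "f \<in> borel_measurable borel" using f by auto
  have "integrable (density (distr lborel borel (\<lambda>x. t + c *\<^sub>R x)) (\<lambda>_. \<bar>c\<bar> ^ DIM('a))) f"
    using f lborel_affine[OF c, of t] by simp
  then show "integrable lborel (\<lambda>x. f (t + c *\<^sub>R x))"
    using c by (simp add: integrable_density integrable_distr_eq)
  show "(\<integral>x. f x \<partial>lborel) = \<bar>c\<bar> ^ DIM('a) * (\<integral>x. f (t + c *\<^sub>R x) \<partial>lborel)"
    by (subst lborel_affine[OF c, of t]) (simp add: integral_density integral_distr)
qed

lemma nn_integral_lborel_affine: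
  fixes f :: "'a::euclidean_space \<Rightarrow> ennreal" and c :: real and t :: 'a
  assumes c: "c \<noteq> 0" and [measurable]: "f \<in> borel_measurable borel"
  shows "(\<integral>\<^sup>+x. f x \<partial>lborel) = ennreal (\<bar>c\<bar> ^ DIM('a)) * (\<integral>\<^sup>+x. f (t + c *\<^sub>R x) \<partial>lborel)"
  by (subst lborel_affine[OF c, of t]) (simp add: nn_integral_density nn_integral_distr nn_integral_cmult)

text \<open>The difference quotients of a compactly supported function have integral zero by
  translation invariance, and they converge boundedly to the derivative.\<close>

lemma integral_derivative_eq_0:
  fixes f :: "'a::euclidean_space \<Rightarrow> real"
  assumes D: "\<And>x. (f has_derivative D x) (at x)"
    and cont: "continuous_on UNIV (\<lambda>x. D x b)"
    and K: "compact K" "\<And>x. x \<notin> K \<Longrightarrow> f x = 0" "\<And>x. x \<notin> K \<Longrightarrow> D x b = 0"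
  shows "(\<integral>x. D x b \<partial>lborel) = 0"
proof -
  have cf: "continuous_on UNIV f"
    using D by (auto simp: continuous_on_eq_continuous_at intro: has_derivative_continuous)
  have [measurable]: "f \<in> borel_measurable borel" "(\<lambda>x. D x b) \<in> borel_measurable borel"
    using cf cont by (auto intro: borel_measurable_continuous_onI)
  have int_f: "integrable lborel f"
    by (rule integrable_lborel_compact_support[OF cf K(1,2)])
  obtain R where R: "\<And>x. x \<in> K \<Longrightarrow> norm x \<le> R"
    using compact_imp_bounded[OF K(1)] by (auto simp: bounded_iff)
  have "bounded ((\<lambda>x. D x b) ` K)"
    by (intro compact_imp_bounded compact_continuous_image continuous_on_subset[OF cont] K) auto
  then obtain M0 where M0: "\<And>x. x \<in> K \<Longrightarrow> \<bar>D x b\<bar> \<le> M0"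
    by (auto simp: bounded_iff)
  define M where "M = max 0 M0"
  have M: "\<bar>D x b\<bar> \<le> M" for x
    using M0[of x] K(3)[of x] by (cases "x \<in> K") (auto simp: M_def)
  define q where "q n x = real (Suc n) * (f (x + (1 / real (Suc n)) *\<^sub>R b) - f x)" for n x
  have lin: "D x (s *\<^sub>R b) = s * D x b" for x s
    using has_derivative_bounded_linear[OF D[of x]] by (simp add: bounded_linear.linear linear_cmul)
  have line: "((\<lambda>t. f (x + t *\<^sub>R b)) has_real_derivative D (x + t *\<^sub>R b) b) (at t)" for x t
  proof -
    have "((\<lambda>t. x + t *\<^sub>R b) has_derivative (\<lambda>s. s *\<^sub>R b)) (at t)"
      by (auto intro!: derivative_eq_intros)
    from has_derivative_compose[OF this D]
    have "((\<lambda>t. f (x + t *\<^sub>R b)) has_derivative (\<lambda>s. D (x + t *\<^sub>R b) (s *\<^sub>R b))) (at t)" .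
    moreover have "(\<lambda>s. D (x + t *\<^sub>R b) (s *\<^sub>R b)) = (*) (D (x + t *\<^sub>R b) b)"
      by (auto simp: lin)
    ultimately show ?thesis by (simp add: has_field_derivative_def)
  qed
  have q_lim: "(\<lambda>n. q n x) \<longlonglongrightarrow> D x b" for x
  proof -
    have "((\<lambda>h. (f (x + h *\<^sub>R b) - f x) / h) \<longlongrightarrow> D x b) (at 0)"
      using line[of x 0] by (simp add: DERIV_def)
    moreover have "filterlim (\<lambda>n. 1 / real (Suc n)) (at 0) sequentially"
      using LIMSEQ_Suc[OF lim_inverse_n'] by (auto simp: filterlim_at)
    ultimately have "(\<lambda>n. (f (x + (1 / real (Suc n)) *\<^sub>R b) - f x) / (1 / real (Suc n))) \<longlonglongrightarrow> D x b"
      by (rule filterlim_compose)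
    then show ?thesis by (simp add: q_def mult.commute)
  qed
  \<comment> \<open>Mean value theorem along the line through x; the quotient vanishes once both x and its translate have left K.\<close>
  have q_bound: "norm (q n x) \<le> M * indicator (cball 0 (R + norm b)) x" for n x
  proof (cases "norm x \<le> R + norm b")
    case True
    have "\<bar>f (x + (1 / real (Suc n)) *\<^sub>R b) - f (x + 0 *\<^sub>R b)\<bar> \<le> M * \<bar>1 / real (Suc n) - 0\<bar>"
      using field_differentiable_bound[of "UNIV" "\<lambda>t. f (x + t *\<^sub>R b)" "\<lambda>t. D (x + t *\<^sub>R b) b" M
          "1 / real (Suc n)" 0] line M by auto
    then have "real (Suc n) * \<bar>f (x + (1 / real (Suc n)) *\<^sub>R b) - f x\<bar> \<le> M"
      by (simp add: field_simps del: of_nat_Suc)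
    then show ?thesis using True by (simp add: q_def abs_mult del: of_nat_Suc)
  next
    case False
    have "norm (x + (1 / real (Suc n)) *\<^sub>R b) \<ge> norm x - norm ((1 / real (Suc n)) *\<^sub>R b)"
      by (metis norm_diff_ineq)
    moreover have "norm ((1 / real (Suc n)) *\<^sub>R b) \<le> norm b"
      by (simp add: field_simps)
    ultimately have "norm (x + (1 / real (Suc n)) *\<^sub>R b) > R" "norm x > R"
      using False norm_ge_zero[of b] by linarith+
    then have "x \<notin> K" "x + (1 / real (Suc n)) *\<^sub>R b \<notin> K" using R by force+
    then show ?thesis using False by (simp add: q_def K)
  qed
  have q_int: "(\<integral>x. q n x \<partial>lborel) = 0" for n
  proof -
    let ?c = "(1 / real (Suc n)) *\<^sub>R b"
    have "integrable lborel (\<lambda>x. f (x + ?c))" "(\<integral>x. f (x + ?c) \<partial>lborel) = (\<integral>x. f x \<partial>lborel)"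
      using integrable_lborel_affine[OF _ int_f, of 1 ?c] integral_lborel_affine[OF _ int_f, of 1 ?c]
      by (simp_all add: add.commute)
    then show ?thesis using int_f by (simp add: q_def)
  qed
  have "(\<lambda>n. \<integral>x. q n x \<partial>lborel) \<longlonglongrightarrow> (\<integral>x. D x b \<partial>lborel)"
  proof (rule integral_dominated_convergence[where w="\<lambda>x::'a. M * indicator (cball 0 (R + norm b)) x"])
    show "integrable lborel (\<lambda>x::'a. M * indicator (cball 0 (R + norm b)) x)"
      using emeasure_lborel_cball_finite[of "0::'a" "R + norm b"]
      by (intro integrable_mult_right integrable_real_indicator) auto
  qed (use q_lim q_bound in \<open>auto simp: q_def\<close>)
  then show ?thesis
    by (simp add: q_int LIMSEQ_const_iff)
qed

lemma test_functions_Ck: "\<phi> \<in> test_functions \<Omega> \<Longrightarrow> Ck k \<phi>"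
  by (simp add: test_functions_def)

lemma test_functions_compact: "\<phi> \<in> test_functions \<Omega> \<Longrightarrow> compact (support \<phi>)"
  by (simp add: test_functions_def)

lemma test_functions_zero: "\<phi> \<in> test_functions \<Omega> \<Longrightarrow> x \<notin> \<Omega> \<Longrightarrow> \<phi> x = 0 \<and> grad \<phi> x = 0"
  using not_in_support[of x \<phi>] grad_off_support[of x \<phi>] by (auto simp: test_functions_def)

lemma test_functions_continuous:
  "\<phi> \<in> test_functions \<Omega> \<Longrightarrow> continuous_on UNIV \<phi> \<and> continuous_on UNIV (grad \<phi>)"
  using Ck_1_continuous continuous_on_grad test_functions_Ck by blast

lemma grad_inner_Basis: "b \<in> Basis \<Longrightarrow> grad \<phi> x \<bullet> b = frechet_derivative \<phi> (at x) b"
  by (simp add: grad_def inner_sum_left inner_Basis if_distrib cong: if_cong)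

lemma integration_by_parts:
  fixes \<phi> \<psi> :: "'a::euclidean_space \<Rightarrow> real"
  assumes "Ck (Suc 0) \<phi>" "Ck (Suc 0) \<psi>" "compact (support \<phi>)" "b \<in> Basis"
  shows "(\<integral>x. \<phi> x * frechet_derivative \<psi> (at x) b \<partial>lborel)
    = - (\<integral>x. frechet_derivative \<phi> (at x) b * \<psi> x \<partial>lborel)"
proof -
  note cont = Ck_1_continuous[OF assms(1)] Ck_1_continuous[OF assms(2)]
    Ck_1_continuous_derivative[OF assms(1,4)] Ck_1_continuous_derivative[OF assms(2,4)]
  have d: "(\<phi> has_derivative frechet_derivative \<phi> (at x)) (at x)"
    "(\<psi> has_derivative frechet_derivative \<psi> (at x)) (at x)" for x
    by (auto intro!: has_derivative_frechet) (use assms in auto)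
  have "(\<integral>x. (\<phi> x * frechet_derivative \<psi> (at x) b + frechet_derivative \<phi> (at x) b * \<psi> x) \<partial>lborel) = 0"
    by (rule integral_derivative_eq_0[where f="\<lambda>x. \<phi> x * \<psi> x" and b=b and K="support \<phi>"
          and D="\<lambda>x h. \<phi> x * frechet_derivative \<psi> (at x) h + frechet_derivative \<phi> (at x) h * \<psi> x"])
      (use assms in \<open>auto intro!: has_derivative_mult d continuous_intros cont
        simp: not_in_support frechet_derivative_off_support\<close>)
  moreover have "integrable lborel (\<lambda>x. \<phi> x * frechet_derivative \<psi> (at x) b)"
    "integrable lborel (\<lambda>x. frechet_derivative \<phi> (at x) b * \<psi> x)"
    by (rule integrable_lborel_compact_support[where K="support \<phi>"],
      use assms in \<open>auto intro!: continuous_intros cont simp: not_in_support frechet_derivative_off_support\<close>)+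
  ultimately show ?thesis by simp
qed

lemma
  fixes f :: "'a::euclidean_space \<Rightarrow> 'b::{banach, second_countable_topology}"
  assumes [measurable]: "f \<in> borel_measurable borel" "\<Omega> \<in> sets borel" and z: "\<And>x. x \<notin> \<Omega> \<Longrightarrow> f x = 0"
  shows integral_lebesgue_on_eq_lborel: "integral\<^sup>L (lebesgue_on \<Omega>) f = integral\<^sup>L lborel f"
    and integrable_lebesgue_on_iff_lborel: "integrable (lebesgue_on \<Omega>) f \<longleftrightarrow> integrable lborel f"
proof -
  have eq: "(\<lambda>x. indicator \<Omega> x *\<^sub>R f x) = f" using z by (auto simp: indicator_def)
  have \<Omega>: "\<Omega> \<inter> space lebesgue \<in> sets lebesgue" using assms(2) by auto
  show "integral\<^sup>L (lebesgue_on \<Omega>) f = integral\<^sup>L lborel f"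
    by (subst integral_restrict_space[OF \<Omega>]) (simp add: eq integral_completion)
  show "integrable (lebesgue_on \<Omega>) f \<longleftrightarrow> integrable lborel f"
    by (subst integrable_restrict_space[OF \<Omega>]) (simp add: eq integrable_completion)
qed

lemma nn_integral_lebesgue_on_eq_lborel:
  assumes [measurable]: "\<Omega> \<in> sets borel" and z: "\<And>x. x \<notin> \<Omega> \<Longrightarrow> f x = 0"
  shows "(\<integral>\<^sup>+x. f x \<partial>lebesgue_on \<Omega>) = (\<integral>\<^sup>+x. f x \<partial>lborel)"
proof -
  have eq: "(\<lambda>x. f x * indicator \<Omega> x) = f" using z by (auto simp: indicator_def)
  have \<Omega>: "\<Omega> \<inter> space lebesgue \<in> sets lebesgue" using assms(1) by auto
  show ?thesis
    by (subst nn_integral_restrict_space[OF \<Omega>]) (simp add: eq nn_integral_completion)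
qed

section \<open>The torsional rigidity in terms of test functions\<close>

text \<open>Numerator and denominator of the torsion quotient for functions that live on the whole space.
  The numerator is not squared here.\<close>

definition mass :: "('a::euclidean_space \<Rightarrow> real) \<Rightarrow> ennreal" where
  "mass \<phi> = (\<integral>\<^sup>+x. ennreal \<bar>\<phi> x\<bar> \<partial>lborel)"

definition energy :: "('a::euclidean_space \<Rightarrow> real) \<Rightarrow> ennreal" where
  "energy \<phi> = (\<integral>\<^sup>+x. ennreal ((norm (grad \<phi> x))\<^sup>2) \<partial>lborel)"

lemma test_function_integrable:
  assumes "\<phi> \<in> test_functions \<Omega>"
  shows "integrable lborel (\<lambda>x. \<bar>\<phi> x\<bar>)" "integrable lborel (\<lambda>x. (norm (grad \<phi> x))\<^sup>2)"
    "integrable lborel (\<lambda>x. (\<phi> x)\<^sup>2)"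
  using assms test_functions_continuous[OF assms]
  by (auto intro!: integrable_lborel_compact_support[where K="support \<phi>"] continuous_intros
      dest: test_functions_compact simp: not_in_support grad_off_support)

text \<open>A test function is approximated by itself; what has to be checked is that its classical gradient is
  a weak gradient, which is integration by parts.\<close>

lemma test_function_W12_0:
  fixes \<Omega> :: "'a::euclidean_space set"
  assumes "open \<Omega>" and \<phi>: "\<phi> \<in> test_functions \<Omega>"
  shows "W12_0 \<Omega> \<phi> (grad \<phi>)"
proof -
  have \<Omega>: "\<Omega> \<in> sets borel" using assms by auto
  note cont = test_functions_continuous[OF \<phi>]
  have meas: "\<phi> \<in> borel_measurable borel" "grad \<phi> \<in> borel_measurable borel"
    using cont by (auto intro: borel_measurable_continuous_onI)
  have mon: "f \<in> borel_measurable borel \<Longrightarrow> f \<in> borel_measurable (lebesgue_on \<Omega>)"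
    for f :: "'a \<Rightarrow> 'c::topological_space"
    by (intro measurable_restrict_space1 measurable_completion) auto
  have "L2 \<Omega> \<phi>" "L2 \<Omega> (grad \<phi>)"
    unfolding L2_def using meas test_function_integrable[OF \<phi>] test_functions_zero[OF \<phi>]
    by (auto intro!: mon integrable_lebesgue_on_iff_lborel[THEN iffD2] \<Omega>)
  moreover have "(\<integral>x. \<phi> x * frechet_derivative \<psi> (at x) b \<partial>lebesgue_on \<Omega>)
          = - (\<integral>x. (grad \<phi> x \<bullet> b) * \<psi> x \<partial>lebesgue_on \<Omega>)"
    if \<psi>: "\<psi> \<in> test_functions \<Omega>" and b: "b \<in> Basis" for \<psi> b
  proof -
    have c: "continuous_on UNIV (\<lambda>x. \<phi> x * frechet_derivative \<psi> (at x) b)"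
      using cont Ck_1_continuous_derivative[OF test_functions_Ck[OF \<psi>] b] by (intro continuous_intros) auto
    have c': "continuous_on UNIV (\<lambda>x. (grad \<phi> x \<bullet> b) * \<psi> x)"
      using cont test_functions_continuous[OF \<psi>] by (intro continuous_intros) auto
    have "(\<integral>x. \<phi> x * frechet_derivative \<psi> (at x) b \<partial>lebesgue_on \<Omega>) = (\<integral>x. \<phi> x * frechet_derivative \<psi> (at x) b \<partial>lborel)"
      by (rule integral_lebesgue_on_eq_lborel)
        (use test_functions_zero[OF \<phi>] c in \<open>auto intro: \<Omega> borel_measurable_continuous_onI\<close>)
    also have "\<dots> = - (\<integral>x. frechet_derivative \<phi> (at x) b * \<psi> x \<partial>lborel)"
      by (rule integration_by_parts) (use \<phi> \<psi> b test_functions_Ck test_functions_compact in blast)+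
    also have "\<dots> = - (\<integral>x. (grad \<phi> x \<bullet> b) * \<psi> x \<partial>lborel)"
      by (simp add: grad_inner_Basis[OF b])
    also have "(\<integral>x. (grad \<phi> x \<bullet> b) * \<psi> x \<partial>lborel) = (\<integral>x. (grad \<phi> x \<bullet> b) * \<psi> x \<partial>lebesgue_on \<Omega>)"
      by (rule integral_lebesgue_on_eq_lborel[symmetric])
        (use test_functions_zero[OF \<psi>] c' in \<open>auto intro: \<Omega> borel_measurable_continuous_onI\<close>)
    finally show ?thesis .
  qed
  ultimately have "W12 \<Omega> \<phi> (grad \<phi>)" by (auto simp: W12_def)
  then show ?thesis
    unfolding W12_0_def using \<phi> by (auto intro!: exI[of _ "\<lambda>_. \<phi>"])
qed

lemma test_function_quotient_le_torsion:
  assumes "open \<Omega>" and \<phi>: "\<phi> \<in> test_functions \<Omega>" and "mass \<phi> \<noteq> 0"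
  shows "(mass \<phi>)\<^sup>2 / energy \<phi> \<le> torsional_rigidity \<Omega>"
proof -
  have \<Omega>: "\<Omega> \<in> sets borel" using assms by auto
  have eq: "(\<integral>\<^sup>+x. ennreal \<bar>\<phi> x\<bar> \<partial>lebesgue_on \<Omega>) = mass \<phi>"
    "(\<integral>\<^sup>+x. ennreal ((norm (grad \<phi> x))\<^sup>2) \<partial>lebesgue_on \<Omega>) = energy \<phi>"
    unfolding mass_def energy_def
    using test_functions_zero[OF \<phi>] by (auto intro!: nn_integral_lebesgue_on_eq_lborel \<Omega>)
  have "\<not> (AE x in lebesgue_on \<Omega>. \<phi> x = 0)"
  proof
    assume "AE x in lebesgue_on \<Omega>. \<phi> x = 0"
    then have "AE x in lebesgue_on \<Omega>. ennreal \<bar>\<phi> x\<bar> = 0" by auto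
    then have "(\<integral>\<^sup>+x. ennreal \<bar>\<phi> x\<bar> \<partial>lebesgue_on \<Omega>) = (\<integral>\<^sup>+x. 0 \<partial>lebesgue_on \<Omega>)"
      by (rule nn_integral_cong_AE)
    then show False using eq assms by simp
  qed
  then show ?thesis
    unfolding torsional_rigidity_def using test_function_W12_0[OF assms(1,2)]
    by (intro Sup_upper CollectI exI[of _ \<phi>] exI[of _ "grad \<phi>"]) (auto simp: eq)
qed

text \<open>The product form of the quotient inequality has no division by zero. It needs a finite rigidity:
  for energy \<open>0\<close> the product \<open>\<infinity> * 0\<close> would be \<open>0\<close>.\<close>

lemma test_function_mass_energy:
  assumes "open \<Omega>" and \<phi>: "\<phi> \<in> test_functions \<Omega>" and fin: "torsional_rigidity \<Omega> < \<infinity>"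
  shows "(mass \<phi>)\<^sup>2 \<le> torsional_rigidity \<Omega> * energy \<phi>"
proof (cases "mass \<phi> = 0")
  case True
  then show ?thesis by (simp add: power2_eq_square)
next
  case False
  note le = test_function_quotient_le_torsion[OF assms(1,2) False]
  have "energy \<phi> \<noteq> 0"
  proof
    assume "energy \<phi> = 0"
    moreover have "(mass \<phi>)\<^sup>2 \<noteq> 0" using False by (simp add: power2_eq_square)
    ultimately have "(mass \<phi>)\<^sup>2 / energy \<phi> = \<infinity>"
      by (simp add: ennreal_divide_zero)
    then show False using le fin by auto
  qed
  moreover have "energy \<phi> \<noteq> \<infinity>"
    unfolding energy_def using test_function_integrable(2)[OF \<phi>]
    by (subst nn_integral_eq_integral) auto
  ultimately have "energy \<phi> / energy \<phi> = 1"
    by (intro ennreal_divide_self) (auto simp: less_top)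
  then have "(mass \<phi>)\<^sup>2 = (mass \<phi>)\<^sup>2 / energy \<phi> * energy \<phi>"
    by (simp only: ennreal_divide_times mult_1_right)
  also have "\<dots> \<le> torsional_rigidity \<Omega> * energy \<phi>"
    by (intro mult_right_mono le) auto
  finally show ?thesis .
qed

lemma abs_le_delta: "\<delta> > 0 \<Longrightarrow> \<bar>y\<bar> \<le> \<delta> + y\<^sup>2 / \<delta>" for y \<delta> :: real
proof -
  assume d: "\<delta> > 0"
  have "0 \<le> (\<bar>y\<bar> - \<delta>)\<^sup>2" by simp
  then have "2 * \<bar>y\<bar> * \<delta> \<le> \<delta>\<^sup>2 + y\<^sup>2" by (simp add: power2_diff)
  then have "\<bar>y\<bar> * \<delta> \<le> \<delta>\<^sup>2 + y\<^sup>2" using d mult_nonneg_nonneg[of "\<bar>y\<bar>" \<delta>] by linarith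
  then show ?thesis using d by (simp add: field_simps power2_eq_square)
qed

text \<open>Young's inequality. In this form and the previous one it replaces the Cauchy-Schwarz and Minkowski
  inequalities for integrals: an \<open>L\<^sup>2\<close> error is split off at the price of a factor \<open>1 + \<delta>\<close>.\<close>

lemma norm_sum_sq_le_delta:
  fixes x y :: "'a::real_inner"
  assumes "\<delta> > 0"
  shows "(norm (x + y))\<^sup>2 \<le> (1 + \<delta>) * (norm x)\<^sup>2 + (1 + 1 / \<delta>) * (norm y)\<^sup>2"
proof -
  have "0 \<le> (norm (\<delta> *\<^sub>R x - y))\<^sup>2" by simp
  also have "\<dots> = \<delta>\<^sup>2 * (norm x)\<^sup>2 - 2 * \<delta> * (x \<bullet> y) + (norm y)\<^sup>2"
    by (simp only: power2_norm_eq_inner) (simp add: inner_diff inner_commute algebra_simps power2_eq_square)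
  finally have "2 * \<delta> * (x \<bullet> y) \<le> \<delta>\<^sup>2 * (norm x)\<^sup>2 + (norm y)\<^sup>2" by simp
  then have "2 * (x \<bullet> y) \<le> \<delta> * (norm x)\<^sup>2 + (norm y)\<^sup>2 / \<delta>"
    using assms by (simp add: field_simps power2_eq_square)
  moreover have "(norm (x + y))\<^sup>2 = (norm x)\<^sup>2 + 2 * (x \<bullet> y) + (norm y)\<^sup>2"
    by (simp add: power2_norm_eq_inner inner_add inner_commute)
  ultimately show ?thesis by (simp add: algebra_simps)
qed

text \<open>Test functions suffice for bounding the rigidity from above. Along a sequence of test functions
  that converges to \<open>u\<close> in \<open>W\<^sup>1\<^sup>,\<^sup>2\<close> the integrals of \<open>\<bar>\<phi> n\<bar>\<close> converge to that of \<open>\<bar>u\<bar>\<close>, since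
  \<open>\<Omega>\<close> has finite measure, and the energies are asymptotically at most the energy of \<open>u\<close>; so the inequality
  passes to the limit.\<close>

lemma torsion_bound_of_test_functions:
  fixes \<Omega> :: "'a::euclidean_space set"
  assumes "open \<Omega>" "bounded \<Omega>" and S: "S \<ge> 0"
    and le: "\<And>\<phi>. \<phi> \<in> test_functions \<Omega> \<Longrightarrow> (mass \<phi>)\<^sup>2 \<le> ennreal S * energy \<phi>"
  shows "torsional_rigidity \<Omega> \<le> ennreal S"
  unfolding torsional_rigidity_def
proof (rule Sup_least, clarify)
  fix u :: "'a \<Rightarrow> real" and g
  assume W: "W12_0 \<Omega> u g" and nz: "\<not> (AE x in lebesgue_on \<Omega>. u x = 0)"
  define M where "M = lebesgue_on \<Omega>"
  have \<Omega>: "\<Omega> \<in> sets borel" using assms by auto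
  have "emeasure lebesgue \<Omega> < \<infinity>"
    using emeasure_bounded_finite[OF \<open>bounded \<Omega>\<close>] \<Omega> by simp
  then interpret finite_measure M
    unfolding M_def using \<Omega>
    by (intro finite_measure_restrict_space[of lebesgue] finite_measureI)
       (auto simp: emeasure_restrict_space space_restrict_space)
  obtain \<phi> where \<phi>: "\<And>n. \<phi> n \<in> test_functions \<Omega>"
    and lim: "(\<lambda>n. \<integral>x. (\<phi> n x - u x)\<^sup>2 + (norm (grad (\<phi> n) x - g x))\<^sup>2 \<partial>M) \<longlonglongrightarrow> 0"
    using W by (auto simp: W12_0_def M_def)
  have L2: "u \<in> borel_measurable M" "integrable M (\<lambda>x. (u x)\<^sup>2)"
    "g \<in> borel_measurable M" "integrable M (\<lambda>x. (norm (g x))\<^sup>2)"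
    using W by (auto simp: W12_0_def W12_def L2_def M_def)
  note [measurable] = L2(1,3)
  have [measurable]: "\<phi> n \<in> borel_measurable M" "grad (\<phi> n) \<in> borel_measurable M" for n
    unfolding M_def using test_functions_continuous[OF \<phi>[of n]]
    by (auto intro!: measurable_restrict_space1 measurable_completion borel_measurable_continuous_onI)
  have \<phi>_int: "integrable M (\<lambda>x. \<bar>\<phi> n x\<bar>)" "integrable M (\<lambda>x. (norm (grad (\<phi> n) x))\<^sup>2)"
    "integrable M (\<lambda>x. (\<phi> n x)\<^sup>2)"
    and \<phi>_eq: "(\<integral>x. \<bar>\<phi> n x\<bar> \<partial>M) = (\<integral>x. \<bar>\<phi> n x\<bar> \<partial>lborel)"
      "(\<integral>x. (norm (grad (\<phi> n) x))\<^sup>2 \<partial>M) = (\<integral>x. (norm (grad (\<phi> n) x))\<^sup>2 \<partial>lborel)" for n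
  proof -
    have m: "(\<lambda>x. \<bar>\<phi> n x\<bar>) \<in> borel_measurable borel" "(\<lambda>x. (norm (grad (\<phi> n) x))\<^sup>2) \<in> borel_measurable borel"
      "(\<lambda>x. (\<phi> n x)\<^sup>2) \<in> borel_measurable borel"
      using test_functions_continuous[OF \<phi>[of n]]
      by (auto intro!: borel_measurable_continuous_onI continuous_intros)
    note z = test_functions_zero[OF \<phi>[of n]]
    show "integrable M (\<lambda>x. \<bar>\<phi> n x\<bar>)" "integrable M (\<lambda>x. (norm (grad (\<phi> n) x))\<^sup>2)"
      "integrable M (\<lambda>x. (\<phi> n x)\<^sup>2)"
      unfolding M_def using test_function_integrable[OF \<phi>[of n]] m z
      by (simp_all add: integrable_lebesgue_on_iff_lborel[OF _ \<Omega>])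
    show "(\<integral>x. \<bar>\<phi> n x\<bar> \<partial>M) = (\<integral>x. \<bar>\<phi> n x\<bar> \<partial>lborel)"
      "(\<integral>x. (norm (grad (\<phi> n) x))\<^sup>2 \<partial>M) = (\<integral>x. (norm (grad (\<phi> n) x))\<^sup>2 \<partial>lborel)"
      unfolding M_def using m z by (simp_all add: integral_lebesgue_on_eq_lborel[OF _ \<Omega>])
  qed
  have u_int: "integrable M (\<lambda>x. \<bar>u x\<bar>)"
    by (rule Bochner_Integration.integrable_bound[OF Bochner_Integration.integrable_add[OF integrable_const[of 1] L2(2)]])
       (use abs_le_delta[of 1] in auto)
  define e where "e n x = (\<phi> n x - u x)\<^sup>2 + (norm (grad (\<phi> n) x - g x))\<^sup>2" for n x
  have sq_diff: "(norm (x - y))\<^sup>2 \<le> 2 * (norm x)\<^sup>2 + 2 * (norm y)\<^sup>2" for x y :: "'c::real_inner"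
    using norm_sum_sq_le_delta[of 1 x "- y"] by simp
  have e_int: "integrable M (e n)" for n
    unfolding e_def
  proof (rule Bochner_Integration.integrable_add)
    show "integrable M (\<lambda>x. (\<phi> n x - u x)\<^sup>2)"
      by (rule Bochner_Integration.integrable_bound[where f="\<lambda>x. 2 * (\<phi> n x)\<^sup>2 + 2 * (u x)\<^sup>2"])
        (use sq_diff[of "\<phi> n _" "u _"] L2 \<phi>_int in auto)
    show "integrable M (\<lambda>x. (norm (grad (\<phi> n) x - g x))\<^sup>2)"
      by (rule Bochner_Integration.integrable_bound[where f="\<lambda>x. 2 * (norm (grad (\<phi> n) x))\<^sup>2 + 2 * (norm (g x))\<^sup>2"])
        (use sq_diff[of "grad (\<phi> n) _" "g _"] L2 \<phi>_int in auto)
  qed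
  define A where "A = (\<integral>x. \<bar>u x\<bar> \<partial>M)"
  define G where "G = (\<integral>x. (norm (g x))\<^sup>2 \<partial>M)"
  define V where "V = measure M (space M)"
  define E where "E n = (\<integral>x. e n x \<partial>M)" for n
  have E_lim: "E \<longlonglongrightarrow> 0" using lim by (simp add: E_def[abs_def] e_def[abs_def])
  have A_nn: "(\<integral>\<^sup>+x. ennreal \<bar>u x\<bar> \<partial>M) = ennreal A"
    unfolding A_def by (rule nn_integral_eq_integral[OF u_int]) simp
  have G_nn: "(\<integral>\<^sup>+x. ennreal ((norm (g x))\<^sup>2) \<partial>M) = ennreal G"
    unfolding G_def by (rule nn_integral_eq_integral[OF L2(4)]) simp
  have A_nonneg: "A \<ge> 0" and G_nonneg: "G \<ge> 0"
    unfolding A_def G_def by simp_all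
  have "A \<noteq> 0"
  proof
    assume "A = 0"
    then have "AE x in M. \<bar>u x\<bar> = 0"
      using integral_nonneg_eq_0_iff_AE[OF u_int] by (simp add: A_def)
    then have "AE x in M. u x = 0" by simp
    then show False using nz unfolding M_def by blast
  qed
  then have A_pos: "A > 0" using A_nonneg by simp
  have bound_A: "A \<le> (\<integral>x. \<bar>\<phi> n x\<bar> \<partial>M) + \<delta> * V + E n / \<delta>" if "\<delta> > 0" for n \<delta>
  proof -
    have "A \<le> (\<integral>x. \<bar>\<phi> n x\<bar> + \<delta> + e n x / \<delta> \<partial>M)"
      unfolding A_def
    proof (rule integral_mono)
      fix x
      have "\<bar>u x\<bar> \<le> \<bar>\<phi> n x\<bar> + \<bar>\<phi> n x - u x\<bar>" by simp
      also have "\<bar>\<phi> n x - u x\<bar> \<le> \<delta> + (\<phi> n x - u x)\<^sup>2 / \<delta>" by (rule abs_le_delta[OF that])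
      also have "(\<phi> n x - u x)\<^sup>2 / \<delta> \<le> e n x / \<delta>"
        using that by (intro divide_right_mono) (auto simp: e_def)
      finally show "\<bar>u x\<bar> \<le> \<bar>\<phi> n x\<bar> + \<delta> + e n x / \<delta>" by simp
    qed (use u_int \<phi>_int e_int in auto)
    also have "\<dots> = (\<integral>x. \<bar>\<phi> n x\<bar> \<partial>M) + \<delta> * V + E n / \<delta>"
      using \<phi>_int(1)[of n] e_int[of n] by (simp add: E_def V_def mult.commute)
    finally show ?thesis .
  qed
  have bound_G: "(\<integral>x. (norm (grad (\<phi> n) x))\<^sup>2 \<partial>M) \<le> (1 + \<delta>) * G + (1 + 1 / \<delta>) * E n" if "\<delta> > 0" for n \<delta>
  proof -
    have "(\<integral>x. (norm (grad (\<phi> n) x))\<^sup>2 \<partial>M) \<le> (\<integral>x. (1 + \<delta>) * (norm (g x))\<^sup>2 + (1 + 1 / \<delta>) * e n x \<partial>M)"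
    proof (rule integral_mono)
      fix x
      have "(norm (grad (\<phi> n) x))\<^sup>2 \<le> (1 + \<delta>) * (norm (g x))\<^sup>2 + (1 + 1 / \<delta>) * (norm (grad (\<phi> n) x - g x))\<^sup>2"
        using norm_sum_sq_le_delta[OF that, of "g x" "grad (\<phi> n) x - g x"] by simp
      also have "(1 + 1 / \<delta>) * (norm (grad (\<phi> n) x - g x))\<^sup>2 \<le> (1 + 1 / \<delta>) * e n x"
        using that by (intro mult_left_mono) (auto simp: e_def)
      finally show "(norm (grad (\<phi> n) x))\<^sup>2 \<le> (1 + \<delta>) * (norm (g x))\<^sup>2 + (1 + 1 / \<delta>) * e n x" by simp
    qed (use L2 \<phi>_int e_int in auto)
    also have "\<dots> = (1 + \<delta>) * G + (1 + 1 / \<delta>) * E n"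
      using L2(4) e_int[of n] by (simp add: E_def G_def)
    finally show ?thesis .
  qed
  have test: "(\<integral>x. \<bar>\<phi> n x\<bar> \<partial>M)\<^sup>2 \<le> S * (\<integral>x. (norm (grad (\<phi> n) x))\<^sup>2 \<partial>M)" for n
  proof -
    have "mass (\<phi> n) = ennreal (\<integral>x. \<bar>\<phi> n x\<bar> \<partial>M)"
      unfolding mass_def \<phi>_eq by (rule nn_integral_eq_integral) (use test_function_integrable[OF \<phi>] in auto)
    moreover have "energy (\<phi> n) = ennreal (\<integral>x. (norm (grad (\<phi> n) x))\<^sup>2 \<partial>M)"
      unfolding energy_def \<phi>_eq by (rule nn_integral_eq_integral) (use test_function_integrable[OF \<phi>] in auto)
    ultimately show ?thesis
      using le[OF \<phi>[of n]] S by (simp add: ennreal_power ennreal_mult[symmetric] zero_le_mult_iff)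
  qed
  \<comment> \<open>Let n tend to infinity with \<delta> fixed, and afterwards \<delta> to zero.\<close>
  have step1: "A \<le> sqrt (S * ((1 + \<delta>) * G)) + \<delta> * V" if d: "\<delta> > 0" for \<delta>
  proof -
    have "A \<le> sqrt (S * ((1 + \<delta>) * G + (1 + 1 / \<delta>) * E n)) + \<delta> * V + E n / \<delta>" for n
    proof -
      have "(\<integral>x. \<bar>\<phi> n x\<bar> \<partial>M)\<^sup>2 \<le> S * ((1 + \<delta>) * G + (1 + 1 / \<delta>) * E n)"
        using test[of n] mult_left_mono[OF bound_G[OF d, of n] S] by linarith
      then have "(\<integral>x. \<bar>\<phi> n x\<bar> \<partial>M) \<le> sqrt (S * ((1 + \<delta>) * G + (1 + 1 / \<delta>) * E n))"
        by (rule real_le_rsqrt)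
      then show ?thesis using bound_A[OF d, of n] by linarith
    qed
    moreover have "(\<lambda>n. sqrt (S * ((1 + \<delta>) * G + (1 + 1 / \<delta>) * E n)) + \<delta> * V + E n / \<delta>)
        \<longlonglongrightarrow> sqrt (S * ((1 + \<delta>) * G + (1 + 1 / \<delta>) * 0)) + \<delta> * V + 0 / \<delta>"
      by (intro tendsto_intros E_lim) (use d in auto)
    ultimately show ?thesis
      by (intro LIMSEQ_le_const) auto
  qed
  have "A \<le> sqrt (S * G)"
  proof (rule tendsto_lowerbound)
    show "((\<lambda>\<delta>. sqrt (S * ((1 + \<delta>) * G)) + \<delta> * V) \<longlongrightarrow> sqrt (S * G)) (at_right 0)"
    proof -
      have "((\<lambda>\<delta>. sqrt (S * ((1 + \<delta>) * G)) + \<delta> * V) \<longlongrightarrow> sqrt (S * ((1 + 0) * G)) + 0 * V) (at_right 0)"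
        by (intro tendsto_intros)
      then show ?thesis by simp
    qed
    show "\<forall>\<^sub>F \<delta> in at_right 0. A \<le> sqrt (S * ((1 + \<delta>) * G)) + \<delta> * V"
      using step1 by (auto simp: eventually_at_right_less eventually_at intro!: exI[of _ 1])
  qed auto
  then have "A\<^sup>2 \<le> S * G"
    using A_nonneg S G_nonneg by (metis real_sqrt_le_iff real_sqrt_abs abs_of_nonneg real_sqrt_unique)
  moreover have "G > 0"
    using calculation A_pos G_nonneg by (cases "G = 0") auto
  ultimately have "(ennreal A)\<^sup>2 / ennreal G \<le> ennreal S"
    using A_nonneg by (simp add: ennreal_power divide_ennreal field_simps ennreal_leI)
  then show "(\<integral>\<^sup>+x. ennreal \<bar>u x\<bar> \<partial>lebesgue_on \<Omega>)\<^sup>2 / (\<integral>\<^sup>+x. ennreal ((norm (g x))\<^sup>2) \<partial>lebesgue_on \<Omega>) \<le> ennreal S"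
    using A_nn G_nn by (simp add: M_def)
qed

section \<open>Behaviour under inclusions and similarities\<close>

lemma support_affine_comp:
  fixes f :: "'a::euclidean_space \<Rightarrow> 'b::real_normed_vector"
  assumes "t \<noteq> 0" "c \<noteq> 0"
  shows "(\<lambda>x. a + t *\<^sub>R x) ` support (\<lambda>x. c *\<^sub>R f (a + t *\<^sub>R x)) \<subseteq> support f"
    "compact (support f) \<Longrightarrow> compact (support (\<lambda>x. c *\<^sub>R f (a + t *\<^sub>R x)))"
proof -
  let ?T = "\<lambda>x. a + t *\<^sub>R x"
  have sub: "support (\<lambda>x. c *\<^sub>R f (?T x)) \<subseteq> ?T -` support f"
    unfolding support_def
  proof (rule closure_minimal)
    show "{x. c *\<^sub>R f (a + t *\<^sub>R x) \<noteq> 0} \<subseteq> ?T -` closure {x. f x \<noteq> 0}"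
      using closure_subset[of "{x. f x \<noteq> 0}"] by auto
    show "closed (?T -` closure {x. f x \<noteq> 0})"
      by (intro continuous_closed_vimage) (auto intro!: continuous_intros)
  qed
  then show "?T ` support (\<lambda>x. c *\<^sub>R f (?T x)) \<subseteq> support f" by blast
  assume comp: "compact (support f)"
  have "?T -` support f \<subseteq> (\<lambda>y. (1 / t) *\<^sub>R (y - a)) ` support f"
  proof
    fix x assume "x \<in> ?T -` support f"
    then show "x \<in> (\<lambda>y. (1 / t) *\<^sub>R (y - a)) ` support f"
      using assms by (intro image_eqI[of _ _ "?T x"]) auto
  qed
  moreover have "compact ((\<lambda>y. (1 / t) *\<^sub>R (y - a)) ` support f)"
    by (intro compact_continuous_image comp continuous_intros)
  ultimately have "bounded (support (\<lambda>x. c *\<^sub>R f (?T x)))"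
    using bounded_subset[OF compact_imp_bounded] sub by (meson order_trans)
  then show "compact (support (\<lambda>x. c *\<^sub>R f (?T x)))"
    by (simp add: compact_eq_bounded_closed support_def)
qed

lemma frechet_derivative_affine_comp:
  fixes f :: "'a::euclidean_space \<Rightarrow> 'b::real_normed_vector"
  assumes "Ck (Suc 0) f"
  shows "frechet_derivative (\<lambda>x. c *\<^sub>R f (a + t *\<^sub>R x)) (at x) b
    = (c * t) *\<^sub>R frechet_derivative f (at (a + t *\<^sub>R x)) b"
proof -
  have "((\<lambda>x. c *\<^sub>R f (a + t *\<^sub>R x)) has_derivative
      (\<lambda>h. (c * t) *\<^sub>R frechet_derivative f (at (a + t *\<^sub>R x)) h)) (at x)"
    by (intro has_derivative_affine_comp has_derivative_frechet) (use assms in auto)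
  from frechet_derivative_eqI[OF this] show ?thesis by simp
qed

lemma grad_affine_comp:
  "Ck (Suc 0) \<phi> \<Longrightarrow> grad (\<lambda>x. \<phi> (a + t *\<^sub>R x)) x = t *\<^sub>R grad \<phi> (a + t *\<^sub>R x)"
  using frechet_derivative_affine_comp[of \<phi> 1 a t x]
  by (simp add: grad_def scaleR_sum_right)

lemma divergence_affine_comp:
  "Ck (Suc 0) \<phi> \<Longrightarrow> divergence (\<lambda>x. \<phi> (a + t *\<^sub>R x)) x = t * divergence \<phi> (a + t *\<^sub>R x)"
  using frechet_derivative_affine_comp[of \<phi> 1 a t x]
  by (simp add: divergence_def sum_distrib_left)

text \<open>Monotonicity, translation invariance and scaling of the rigidity in one statement: if
  \<open>\<Omega> \<subseteq> a + t \<Omega>'\<close>, a test function on \<open>\<Omega>\<close> pulls back to one on \<open>\<Omega>'\<close>; the mass is divided by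
  \<open>t\<^sup>N\<close> and the energy by \<open>t\<^sup>N\<^sup>-\<^sup>2\<close>.\<close>

lemma torsion_le_of_subset_affine:
  fixes \<Omega> \<Omega>' :: "'a::euclidean_space set"
  assumes "open \<Omega>" "bounded \<Omega>" "open \<Omega>'" and t: "t > 0" and sub: "\<Omega> \<subseteq> (\<lambda>x. a + t *\<^sub>R x) ` \<Omega>'"
  shows "torsional_rigidity \<Omega> \<le> ennreal (t ^ (DIM('a) + 2)) * torsional_rigidity \<Omega>'"
proof (cases "torsional_rigidity \<Omega>' = \<infinity>")
  case True
  then show ?thesis using t by (simp add: ennreal_mult_top)
next
  case False
  then have fin: "torsional_rigidity \<Omega>' < \<infinity>" by (simp add: less_top)
  define N where "N = DIM('a)"
  define S where "S = enn2real (torsional_rigidity \<Omega>')"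
  have S: "torsional_rigidity \<Omega>' = ennreal S" "S \<ge> 0" using fin by (auto simp: S_def)
  have "torsional_rigidity \<Omega> \<le> ennreal (t ^ (N + 2) * S)"
  proof (rule torsion_bound_of_test_functions[OF assms(1,2)])
    fix \<phi> assume \<phi>: "\<phi> \<in> test_functions \<Omega>"
    define \<psi> where "\<psi> x = \<phi> (a + t *\<^sub>R x)" for x
    have \<psi>: "\<psi> \<in> test_functions \<Omega>'"
    proof -
      have supp: "(\<lambda>x. a + t *\<^sub>R x) ` support \<psi> \<subseteq> support \<phi>" "compact (support \<psi>)"
        using support_affine_comp[where t=t and c=1 and a=a and f=\<phi>] test_functions_compact[OF \<phi>] t
        by (simp_all add: \<psi>_def[abs_def])
      have "support \<psi> \<subseteq> \<Omega>'"
      proof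
        fix x assume "x \<in> support \<psi>"
        then have "a + t *\<^sub>R x \<in> support \<phi>" using supp(1) by blast
        then have "a + t *\<^sub>R x \<in> (\<lambda>x. a + t *\<^sub>R x) ` \<Omega>'"
          using \<phi> sub unfolding test_functions_def by blast
        then show "x \<in> \<Omega>'" using t by auto
      qed
      moreover have "Ck k \<psi>" for k
        using Ck_affine_comp[OF test_functions_Ck[OF \<phi>, of k], of 1 a t] by (simp add: \<psi>_def[abs_def])
      ultimately show ?thesis using supp by (simp add: test_functions_def)
    qed
    note meas = test_functions_continuous[OF \<phi>, THEN conjunct1, THEN borel_measurable_continuous_onI]
      test_functions_continuous[OF \<phi>, THEN conjunct2, THEN borel_measurable_continuous_onI]
    have [measurable]: "\<phi> \<in> borel_measurable borel" "grad \<phi> \<in> borel_measurable borel" by (fact meas)+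
    have m: "mass \<phi> = ennreal (t ^ N) * mass \<psi>"
      unfolding mass_def \<psi>_def N_def
      by (subst nn_integral_lborel_affine[where c=t and t=a]) (use t in auto)
    have "energy \<phi> = ennreal (t ^ N) * (\<integral>\<^sup>+ x. ennreal ((norm (grad \<phi> (a + t *\<^sub>R x)))\<^sup>2) \<partial>lborel)"
      unfolding energy_def N_def
      by (subst nn_integral_lborel_affine[where c=t and t=a]) (use t in auto)
    moreover have "energy \<psi> = ennreal (t\<^sup>2) * (\<integral>\<^sup>+ x. ennreal ((norm (grad \<phi> (a + t *\<^sub>R x)))\<^sup>2) \<partial>lborel)"
      unfolding energy_def \<psi>_def[abs_def]
      by (subst nn_integral_cmult[symmetric])
        (auto simp: grad_affine_comp[OF test_functions_Ck[OF \<phi>]] power_mult_distrib ennreal_mult[symmetric])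
    ultimately have e: "ennreal (t\<^sup>2) * energy \<phi> = ennreal (t ^ N) * energy \<psi>"
      by (simp add: mult.left_commute)
    have "(mass \<phi>)\<^sup>2 = ennreal (t ^ N) * (ennreal (t ^ N) * (mass \<psi>)\<^sup>2)"
      by (simp add: m power2_eq_square mult_ac)
    also have "\<dots> \<le> ennreal (t ^ N) * (ennreal (t ^ N) * (ennreal S * energy \<psi>))"
      using test_function_mass_energy[OF assms(3) \<psi> fin] S by (intro mult_left_mono) auto
    also have "\<dots> = ennreal (t ^ N) * (ennreal S * (ennreal (t\<^sup>2) * energy \<phi>))"
      by (metis (no_types, lifting) e mult.left_commute)
    also have "\<dots> = ennreal (t ^ (N + 2) * S) * energy \<phi>"
      using t S by (simp add: ennreal_mult power_add power2_eq_square mult_ac)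
    finally show "(mass \<phi>)\<^sup>2 \<le> ennreal (t ^ (N + 2) * S) * energy \<phi>" .
  qed (use t S in auto)
  then show ?thesis using t S by (simp add: ennreal_mult N_def)
qed

lemma integral_lebesgue_on_continuous:
  fixes f :: "'a::euclidean_space \<Rightarrow> real"
  assumes "continuous_on UNIV f" "B \<in> sets borel"
  shows "(\<integral>x. f x \<partial>lebesgue_on B) = (\<integral>x. indicator B x * f x \<partial>lborel)"
proof -
  have [measurable]: "f \<in> borel_measurable borel" "B \<in> sets borel"
    using assms by (auto intro: borel_measurable_continuous_onI)
  have B: "B \<inter> space lebesgue \<in> sets lebesgue" using assms by auto
  show ?thesis by (subst integral_restrict_space[OF B]) (simp add: integral_completion)
qed

text \<open>Vector fields transported by a homothety are again competitors, since composition with an affine map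
  does not change the sup norm.\<close>

lemma perimeter_affine_image_le:
  fixes E :: "'a::euclidean_space set"
  assumes E: "E \<in> sets borel" and t: "t > 0"
  shows "ennreal (t ^ (DIM('a) - 1)) * perimeter ((\<lambda>x. a + t *\<^sub>R x) -` E) \<le> perimeter E"
proof -
  let ?T = "\<lambda>x. a + t *\<^sub>R x"
  define N where "N = DIM('a)"
  have N: "t ^ N = t * t ^ (N - 1)"
    using DIM_positive[where 'a='a] by (metis N_def power_minus_mult mult.commute)
  have meas: "?T -` E \<in> sets borel"
    using measurable_sets[of ?T borel borel E] E by simp
  have step: "ennreal (t ^ (N - 1)) * ennreal (\<integral>x. divergence \<phi> x \<partial>lebesgue_on (?T -` E)) \<le> perimeter E"
    if \<phi>: "Ck 1 \<phi>" "compact (support \<phi>)" "\<forall>x. norm (\<phi> x) \<le> 1" for \<phi> :: "'a \<Rightarrow> 'a"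
  proof -
    define \<psi> where "\<psi> y = \<phi> (- (1 / t) *\<^sub>R a + (1 / t) *\<^sub>R y)" for y
    have C: "Ck (Suc 0) \<phi>" using \<phi> by simp
    have \<psi>: "Ck 1 \<psi>" "compact (support \<psi>)" "\<forall>x. norm (\<psi> x) \<le> 1"
      using Ck_affine_comp[OF \<phi>(1), of 1 "- (1 / t) *\<^sub>R a" "1 / t"] \<phi>(2,3) t
        support_affine_comp(2)[of "1 / t" 1 \<phi> "- (1 / t) *\<^sub>R a"]
      unfolding \<psi>_def[abs_def] by simp_all
    have C\<psi>: "Ck (Suc 0) \<psi>" using \<psi> by simp
    have div: "divergence \<psi> (?T x) = (1 / t) * divergence \<phi> x" for x
      unfolding \<psi>_def[abs_def] divergence_affine_comp[OF C] using t by (simp add: algebra_simps)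
    have ib: "integrable lborel (\<lambda>x. indicator E x * divergence \<psi> x)"
    proof -
      have "integrable lborel (divergence \<psi>)"
        by (rule integrable_lborel_compact_support[OF continuous_on_divergence[OF C\<psi>] \<psi>(2) divergence_off_support])
      then show ?thesis using integrable_mult_indicator[of E lborel "divergence \<psi>"] E by simp
    qed
    have "(\<integral>x. divergence \<psi> x \<partial>lebesgue_on E) = (\<integral>x. indicator E x * divergence \<psi> x \<partial>lborel)"
      by (rule integral_lebesgue_on_continuous[OF continuous_on_divergence[OF C\<psi>] E])
    also have "\<dots> = t ^ N * (\<integral>x. indicator E (?T x) * divergence \<psi> (?T x) \<partial>lborel)"
      using integral_lborel_affine[OF _ ib, of t a] t by (simp add: N_def)
    also have "(\<lambda>x. indicator E (?T x) * divergence \<psi> (?T x))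
        = (\<lambda>x. (1 / t) * (indicator (?T -` E) x * divergence \<phi> x))"
      by (auto simp: div indicator_def)
    also have "t ^ N * (\<integral>x. (1 / t) * (indicator (?T -` E) x * divergence \<phi> x) \<partial>lborel)
        = t ^ (N - 1) * (\<integral>x. indicator (?T -` E) x * divergence \<phi> x \<partial>lborel)"
      using t by (simp add: N)
    also have "(\<integral>x. indicator (?T -` E) x * divergence \<phi> x \<partial>lborel) = (\<integral>x. divergence \<phi> x \<partial>lebesgue_on (?T -` E))"
      by (rule integral_lebesgue_on_continuous[OF continuous_on_divergence[OF C] meas, symmetric])
    finally have "ennreal (t ^ (N - 1)) * ennreal (\<integral>x. divergence \<phi> x \<partial>lebesgue_on (?T -` E))
        = ennreal (\<integral>x. divergence \<psi> x \<partial>lebesgue_on E)"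
      using t by (simp add: ennreal_mult'[symmetric])
    also have "\<dots> \<le> perimeter E"
      unfolding perimeter_def using \<psi> by (intro Sup_upper) blast
    finally show ?thesis .
  qed
  show ?thesis
    unfolding perimeter_def[of "?T -` E"] N_def[symmetric]
    by (subst image_ident[symmetric], subst SUP_mult_left_ennreal) (rule SUP_least, clarify, rule step)
qed

text \<open>The counterpart of \<open>torsion_le_of_subset_affine\<close> for the Cheeger constant, which decreases as the set
  grows: sets in the closure of \<open>\<Omega>\<close> pull back into the closure of \<open>\<Omega>'\<close>, and the quotient
  \<open>P(E) / \<bar>E\<bar>\<close> has degree \<open>-1\<close> under scaling.\<close>

lemma cheeger_le_of_subset_affine:
  fixes \<Omega> \<Omega>' :: "'a::euclidean_space set"
  assumes t: "t > 0" and sub: "\<Omega> \<subseteq> (\<lambda>x. a + t *\<^sub>R x) ` \<Omega>'"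
  shows "cheeger_constant \<Omega>' \<le> ennreal t * cheeger_constant \<Omega>"
proof -
  let ?T = "\<lambda>x. a + t *\<^sub>R x"
  define N where "N = DIM('a)"
  have N: "t ^ N = t * t ^ (N - 1)"
    using DIM_positive[where 'a='a] by (metis N_def power_minus_mult mult.commute)
  have step: "cheeger_constant \<Omega>' / ennreal t \<le> perimeter E / emeasure lebesgue E"
    if E: "E \<in> sets borel" "E \<subseteq> closure \<Omega>" "emeasure lebesgue E > 0" for E
  proof -
    define E' where "E' = ?T -` E"
    have E': "E' \<in> sets borel"
      using measurable_sets[of ?T borel borel E] E by (simp add: E'_def)
    have em: "emeasure lebesgue E = ennreal (t ^ N) * emeasure lebesgue E'"
    proof -
      have [measurable]: "E \<in> sets borel" by fact
      have "emeasure lborel E = (\<integral>\<^sup>+x. indicator E x \<partial>lborel)" by simp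
      also have "\<dots> = ennreal (t ^ N) * (\<integral>\<^sup>+x. indicator E (?T x) \<partial>lborel)"
        by (subst nn_integral_lborel_affine[where c=t and t=a]) (use t N_def in auto)
      also have "(\<lambda>x. indicator E (?T x)) = indicator E'" by (auto simp: E'_def indicator_def)
      also have "(\<integral>\<^sup>+x. indicator E' x \<partial>lborel) = emeasure lborel E'" using E' by simp
      finally show ?thesis using E E' by simp
    qed
    have clos: "closure \<Omega> \<subseteq> ?T ` closure \<Omega>'"
    proof (rule closure_minimal)
      show "\<Omega> \<subseteq> ?T ` closure \<Omega>'" using sub closure_subset by blast
      show "closed (?T ` closure \<Omega>')"
        using closed_translation[OF closed_scaling[OF closed_closure[of \<Omega>'], of t], of a]
        by (simp add: image_image)
    qed
    have "E' \<subseteq> closure \<Omega>'"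
      using E(2) clos t unfolding E'_def by fastforce
    moreover have "emeasure lebesgue E' > 0" using E(3) em by (auto intro!: gr_zeroI)
    ultimately have "cheeger_constant \<Omega>' \<le> perimeter E' / emeasure lebesgue E'"
      unfolding cheeger_constant_def using E' by (intro Inf_lower) blast
    then have "cheeger_constant \<Omega>' / ennreal t \<le> perimeter E' / emeasure lebesgue E' / ennreal t"
      by (rule divide_right_mono_ennreal)
    also have "\<dots> = (ennreal (t ^ (N - 1)) * perimeter E') / (ennreal (t ^ N) * emeasure lebesgue E')"
    proof -
      have c: "ennreal (t ^ (N - 1)) \<noteq> 0" "ennreal (t ^ (N - 1)) \<noteq> \<infinity>" using t by auto
      have "perimeter E' / emeasure lebesgue E' / ennreal t = perimeter E' / (ennreal t * emeasure lebesgue E')"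
        using t by (cases "emeasure lebesgue E'")
          (auto simp: divide_ennreal_def ennreal_inverse_mult mult_ac ennreal_mult_top)
      also have "\<dots> = perimeter E' * ennreal (t ^ (N - 1)) / (ennreal t * emeasure lebesgue E' * ennreal (t ^ (N - 1)))"
        by (rule divide_mult_eq[OF c, symmetric])
      also have "ennreal t * emeasure lebesgue E' * ennreal (t ^ (N - 1)) = ennreal (t ^ N) * emeasure lebesgue E'"
        using t by (simp add: N ennreal_mult mult_ac)
      finally show ?thesis by (simp add: mult.commute)
    qed
    also have "\<dots> \<le> perimeter E / emeasure lebesgue E"
      unfolding em using perimeter_affine_image_le[OF E(1) t, of a]
      by (intro divide_right_mono_ennreal) (auto simp: N_def E'_def)
    finally show ?thesis .
  qed
  have "cheeger_constant \<Omega>' / ennreal t \<le> cheeger_constant \<Omega>"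
    unfolding cheeger_constant_def[of \<Omega>] using step by (intro Inf_greatest) blast
  then have "ennreal t * (cheeger_constant \<Omega>' / ennreal t) \<le> ennreal t * cheeger_constant \<Omega>"
    by (rule mult_left_mono) simp
  moreover have "ennreal t * (cheeger_constant \<Omega>' / ennreal t) = cheeger_constant \<Omega>'"
    using t by (simp add: ennreal_times_divide mult_divide_eq_ennreal mult.commute[of "ennreal t"])
  ultimately show ?thesis by simp
qed

section \<open>Lower bounds for the rigidity and the Cheeger constant\<close>

lemma bump_smooth: "bump \<in> smooth_fns"
  using smooth_fns_bump_affine[of 1 0] by (simp add: eta_contract_eq)

lemma bump_Ck: "Ck k bump"
  by (rule smooth_fns_Ck[OF bump_smooth])

lemma support_bump: "support bump = cball 0 1"
proof -
  have "{x::'a. bump x \<noteq> 0} = ball 0 1" by (auto simp: bump_nonzero_iff)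
  then show ?thesis by (simp add: support_def)
qed

lemma bump_test_function: "bump \<in> test_functions UNIV"
  by (simp add: test_functions_def bump_Ck support_bump)

lemma mass_bump_pos: "mass (bump :: 'a::euclidean_space \<Rightarrow> real) \<noteq> 0"
proof
  assume z: "mass (bump :: 'a \<Rightarrow> real) = 0"
  have [measurable]: "(bump :: 'a \<Rightarrow> real) \<in> borel_measurable borel"
    using Ck_1_continuous[OF bump_Ck] by (rule borel_measurable_continuous_onI)
  have "AE x in lborel. bump (x::'a) = 0"
    using z unfolding mass_def by (subst (asm) nn_integral_0_iff_AE) auto
  then have "{x\<in>space lborel. bump (x::'a) \<noteq> 0} \<in> null_sets lborel"
    by (subst (asm) AE_iff_null) auto
  moreover have "{x\<in>space lborel. bump (x::'a) \<noteq> 0} = ball 0 1" by (auto simp: bump_nonzero_iff)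
  ultimately have "negligible (ball (0::'a) 1)"
    by (simp add: negligible_iff_null_sets null_sets_completionI)
  then show False using open_not_negligible[of "ball (0::'a) 1"] by simp
qed

text \<open>Superadditivity of the rigidity: for the sum of bumps on \<open>k\<close> disjoint unit balls, both the mass and the
  energy are \<open>k\<close> times those of one bump, and the squared mass divided by the energy grows like \<open>k\<close>.\<close>

lemma torsion_ge_of_disjoint_balls:
  "\<exists>c>0. \<forall>(\<Omega>::'a::euclidean_space set) a (k::nat). open \<Omega> \<longrightarrow> 0 < k \<longrightarrow>
     (\<forall>i<k. cball (a i) 1 \<subseteq> \<Omega>) \<longrightarrow> (\<forall>i<k. \<forall>j<k. i \<noteq> j \<longrightarrow> dist (a i) (a j) \<ge> 2) \<longrightarrow>
     ennreal (c * real k) \<le> torsional_rigidity \<Omega>"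
proof -
  let ?B = "bump :: 'a \<Rightarrow> real"
  define A where "A = enn2real (mass ?B)"
  define D where "D = enn2real (energy ?B)"
  have "mass ?B < \<infinity>" "energy ?B < \<infinity>"
    unfolding mass_def energy_def using test_function_integrable[OF bump_test_function[where 'a='a]]
    by (auto simp: nn_integral_eq_integral)
  then have A: "mass ?B = ennreal A" "A > 0" and D: "energy ?B = ennreal D" "D \<ge> 0"
    using mass_bump_pos[where 'a='a] by (auto simp: A_def D_def enn2real_positive_iff zero_less_iff_neq_zero less_top)
  show ?thesis
  proof (intro exI[of _ "A\<^sup>2 / (D + 1)"] conjI allI impI)
    \<comment> \<open>The summand 1 keeps the constant meaningful without a proof that the bump has positive energy.\<close>
    show "A\<^sup>2 / (D + 1) > 0" using A D by simp
    fix \<Omega> :: "'a set" and a :: "nat \<Rightarrow> 'a" and k :: nat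
    assume \<Omega>: "open \<Omega>" and k: "0 < k" and sub: "\<forall>i<k. cball (a i) 1 \<subseteq> \<Omega>"
      and sep: "\<forall>i<k. \<forall>j<k. i \<noteq> j \<longrightarrow> dist (a i) (a j) \<ge> 2"
    define \<phi> where "\<phi> x = (\<Sum>i<k. ?B (x - a i))" for x
    have smooth: "\<phi> \<in> smooth_fns"
      unfolding \<phi>_def[abs_def] using smooth_fns_bump_affine[of 1]
      by (intro smooth_fns_sum) auto
    have "{x. \<phi> x \<noteq> 0} \<subseteq> (\<Union>i<k. cball (a i) 1)"
    proof
      fix x assume "x \<in> {x. \<phi> x \<noteq> 0}"
      then obtain i where "i < k" "?B (x - a i) \<noteq> 0"
        unfolding \<phi>_def by (auto elim: sum.not_neutral_contains_not_neutral)
      then show "x \<in> (\<Union>i<k. cball (a i) 1)"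
        by (auto simp: bump_nonzero_iff dist_norm norm_minus_commute intro!: bexI[of _ i])
    qed
    then have supp: "support \<phi> \<subseteq> (\<Union>i<k. cball (a i) 1)"
      unfolding support_def by (intro closure_minimal) auto
    have "compact (support \<phi>)"
      using bounded_subset[OF _ supp] unfolding compact_eq_bounded_closed
      by (auto simp: support_def)
    then have \<phi>: "\<phi> \<in> test_functions \<Omega>"
      using supp sub smooth_fns_Ck[OF smooth] by (auto simp: test_functions_def)
    have cont: "continuous_on UNIV ?B" "continuous_on UNIV (grad ?B)"
      using test_functions_continuous[OF bump_test_function] by auto
    have [measurable]: "?B \<in> borel_measurable borel" "grad ?B \<in> borel_measurable borel"
      using cont by (auto intro: borel_measurable_continuous_onI)
    have shift: "(\<integral>\<^sup>+x. f (x - y) \<partial>lborel) = (\<integral>\<^sup>+x. f x \<partial>lborel)"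
      if [measurable]: "f \<in> borel_measurable borel" for f :: "'a \<Rightarrow> ennreal" and y
      using nn_integral_lborel_affine[of 1 f "- y"] by simp
    have "mass \<phi> = (\<integral>\<^sup>+x. (\<Sum>i<k. ennreal \<bar>?B (x - a i)\<bar>) \<partial>lborel)"
      unfolding mass_def \<phi>_def by (simp add: bump_nonneg sum_nonneg sum_ennreal)
    also have "\<dots> = (\<Sum>i<k. \<integral>\<^sup>+x. ennreal \<bar>?B (x - a i)\<bar> \<partial>lborel)"
      by (rule nn_integral_sum) auto
    also have "\<dots> = (\<Sum>i<k. mass ?B)"
      unfolding mass_def by (intro sum.cong refl shift[of "\<lambda>x. ennreal \<bar>?B x\<bar>"]) auto
    also have "\<dots> = ennreal (real k * A)"
      using A by (simp add: ennreal_mult ennreal_of_nat_eq_real_of_nat)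
    finally have m: "mass \<phi> = ennreal (real k * A)" .
    have gB: "grad (\<lambda>x. ?B (x - y)) x = grad ?B (x - y)" for x y
      using grad_affine_comp[OF bump_Ck, of "- y" 1 x] by simp
    have g: "grad \<phi> x = (\<Sum>i<k. grad ?B (x - a i))" for x
    proof -
      have diff: "(\<lambda>x. ?B (x - a i)) differentiable at x" for i
        using smooth_fns_Ck[OF smooth_fns_bump_affine[of 1 "a i"], of 1] by simp
      have "(\<phi> has_derivative (\<lambda>h. \<Sum>i<k. frechet_derivative (\<lambda>x. ?B (x - a i)) (at x) h)) (at x)"
        unfolding \<phi>_def[abs_def] by (intro has_derivative_sum has_derivative_frechet diff)
      from frechet_derivative_eqI[OF this]
      have "grad \<phi> x = (\<Sum>b\<in>Basis. \<Sum>i<k. frechet_derivative (\<lambda>x. ?B (x - a i)) (at x) b *\<^sub>R b)"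
        by (simp add: grad_def scaleR_sum_left)
      also have "\<dots> = (\<Sum>i<k. grad (\<lambda>x. ?B (x - a i)) x)"
        unfolding grad_def by (rule sum.swap)
      finally show ?thesis by (simp add: gB)
    qed
    \<comment> \<open>On the unit sphere itself the gradient vanishes by continuity; balls that touch have common points there.\<close>
    have g0: "grad ?B y = 0" if "norm y \<ge> 1" for y :: 'a
    proof -
      have "continuous_on UNIV (\<lambda>s. grad ?B (s *\<^sub>R y))"
        by (rule continuous_on_compose2[OF cont(2)]) (auto intro!: continuous_intros)
      then have "((\<lambda>s. grad ?B (s *\<^sub>R y)) \<longlongrightarrow> grad ?B (1 *\<^sub>R y)) (at_right 1)"
        by (metis continuous_on_def UNIV_I tendsto_within_subset top_greatest)
      moreover have "((\<lambda>s. grad ?B (s *\<^sub>R y)) \<longlongrightarrow> 0) (at_right 1)"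
      proof (rule tendsto_eventually)
        show "\<forall>\<^sub>F s in at_right 1. grad ?B (s *\<^sub>R y) = 0"
        proof (rule eventually_at_rightI[of 1 2])
          fix s :: real assume s: "s \<in> {1<..<2}"
          then have "1 * 1 < s * norm y" using that by (intro mult_less_le_imp_less) auto
          then have "s *\<^sub>R y \<notin> support ?B" using s by (simp add: support_bump)
          then show "grad ?B (s *\<^sub>R y) = 0" by (rule grad_off_support)
        qed simp
      qed
      ultimately show ?thesis
        using tendsto_unique trivial_limit_at_right_real by (metis scaleR_one)
    qed
    \<comment> \<open>At every point at most one of the gradients differs from zero, so they are pairwise orthogonal.\<close>
    have g2: "(norm (grad \<phi> x))\<^sup>2 = (\<Sum>i<k. (norm (grad ?B (x - a i)))\<^sup>2)" for x
      unfolding g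
    proof (rule norm_sum_Pythagorean)
      show "pairwise (\<lambda>i j. orthogonal (grad ?B (x - a i)) (grad ?B (x - a j))) {..<k}"
      proof (rule pairwiseI)
        fix i j assume ij: "i \<in> {..<k}" "j \<in> {..<k}" "i \<noteq> j"
        have "2 \<le> norm ((x - a i) - (x - a j))" using sep ij by (simp add: dist_norm norm_minus_commute)
        also have "\<dots> \<le> norm (x - a i) + norm (x - a j)" by (rule norm_triangle_ineq4)
        finally have "norm (x - a i) \<ge> 1 \<or> norm (x - a j) \<ge> 1" by linarith
        then show "orthogonal (grad ?B (x - a i)) (grad ?B (x - a j))"
          using g0 by (auto simp: orthogonal_def)
      qed
    qed simp
    have "energy \<phi> = (\<integral>\<^sup>+x. (\<Sum>i<k. ennreal ((norm (grad ?B (x - a i)))\<^sup>2)) \<partial>lborel)"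
      unfolding energy_def g2 by (simp add: sum_ennreal)
    also have "\<dots> = (\<Sum>i<k. \<integral>\<^sup>+x. ennreal ((norm (grad ?B (x - a i)))\<^sup>2) \<partial>lborel)"
      by (rule nn_integral_sum) auto
    also have "\<dots> = (\<Sum>i<k. energy ?B)"
      unfolding energy_def by (intro sum.cong refl shift[of "\<lambda>x. ennreal ((norm (grad ?B x))\<^sup>2)"]) auto
    also have "\<dots> = ennreal (real k * D)"
      using D by (simp add: ennreal_mult ennreal_of_nat_eq_real_of_nat)
    finally have e: "energy \<phi> = ennreal (real k * D)" .
    have "(mass \<phi>)\<^sup>2 / energy \<phi> \<le> torsional_rigidity \<Omega>"
      by (rule test_function_quotient_le_torsion[OF \<Omega> \<phi>]) (use m k A in simp)
    moreover have "ennreal (A\<^sup>2 / (D + 1) * real k) \<le> (mass \<phi>)\<^sup>2 / energy \<phi>"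
    proof (cases "D = 0")
      case True
      then show ?thesis using m e k A by (simp add: ennreal_power)
    next
      case False
      then have "D > 0" using D by simp
      have "A\<^sup>2 / (D + 1) * real k \<le> A\<^sup>2 / D * real k"
        using \<open>D > 0\<close> by (intro mult_right_mono divide_left_mono) auto
      also have "\<dots> = (real k * A)\<^sup>2 / (real k * D)"
        using k by (simp add: power2_eq_square)
      finally show ?thesis
        using m e k A \<open>D > 0\<close> by (simp add: ennreal_power divide_ennreal ennreal_leI)
    qed
    ultimately show "ennreal (A\<^sup>2 / (D + 1) * real k) \<le> torsional_rigidity \<Omega>" by (rule order_trans[rotated])
  qed
qed

lemma divergence_scaleR_const:
  assumes "(s has_derivative D) (at x)"
  shows "divergence (\<lambda>x. s x *\<^sub>R v) x = D v"
proof -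
  interpret bounded_linear D using assms by (rule has_derivative_bounded_linear)
  have "((\<lambda>x. s x *\<^sub>R v) has_derivative (\<lambda>h. D h *\<^sub>R v)) (at x)"
    by (intro has_derivative_scaleR_left assms)
  from frechet_derivative_eqI[OF this]
  have "divergence (\<lambda>x. s x *\<^sub>R v) x = (\<Sum>b\<in>Basis. (v \<bullet> b) *\<^sub>R D b)"
    by (simp add: divergence_def mult.commute)
  also have "\<dots> = D (\<Sum>b\<in>Basis. (v \<bullet> b) *\<^sub>R b)" by (simp add: sum scaleR)
  finally show ?thesis by (simp add: euclidean_representation)
qed

text \<open>Any admissible field bounds the Cheeger constant from below by the minimum of its divergence, as
  \<open>P(E) \<ge> \<integral>\<^sub>E div \<phi> \<ge> c \<bar>E\<bar>\<close>.\<close>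

lemma cheeger_ge_of_divergence:
  fixes \<Omega> :: "'a::euclidean_space set"
  assumes "bounded \<Omega>" and c: "c \<ge> 0" and \<phi>: "Ck 1 \<phi>" "compact (support \<phi>)" "\<And>x. norm (\<phi> x) \<le> 1"
    and div: "\<And>x. x \<in> closure \<Omega> \<Longrightarrow> divergence \<phi> x \<ge> c"
  shows "ennreal c \<le> cheeger_constant \<Omega>"
  unfolding cheeger_constant_def
proof (rule Inf_greatest, clarify)
  fix E assume E: "E \<in> sets borel" "E \<subseteq> closure \<Omega>" "emeasure lebesgue E > 0"
  have C: "Ck (Suc 0) \<phi>" using \<phi> by simp
  have [measurable]: "E \<in> sets lborel" using E by simp
  have bE: "bounded E" using E assms(1) bounded_subset bounded_closure by metis
  have fin: "emeasure lborel E < \<infinity>" by (rule emeasure_bounded_finite[OF bE])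
  have int: "integrable lborel (divergence \<phi>)"
    by (rule integrable_lborel_compact_support[OF continuous_on_divergence[OF C] \<phi>(2) divergence_off_support])
  have "c * measure lborel E = (\<integral>x. indicator E x * c \<partial>lborel)"
    using fin by simp
  also have "\<dots> \<le> (\<integral>x. indicator E x * divergence \<phi> x \<partial>lborel)"
  proof (rule integral_mono)
    show "integrable lborel (\<lambda>x. indicator E x * c)" using fin E(1) by (intro integrable_mult_left integrable_real_indicator) auto
    show "integrable lborel (\<lambda>x. indicator E x * divergence \<phi> x)"
      using integrable_mult_indicator[OF _ int, of E] E(1) by simp
    show "indicator E x * c \<le> indicator E x * divergence \<phi> x" for x
      using div[of x] E(2) by (auto simp: indicator_def)
  qed
  also have "\<dots> = (\<integral>x. divergence \<phi> x \<partial>lebesgue_on E)"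
    by (rule integral_lebesgue_on_continuous[OF continuous_on_divergence[OF C] E(1), symmetric])
  finally have "ennreal (c * measure lborel E) \<le> ennreal (\<integral>x. divergence \<phi> x \<partial>lebesgue_on E)"
    by (rule ennreal_leI)
  also have "\<dots> \<le> perimeter E"
    unfolding perimeter_def using \<phi> by (intro Sup_upper) blast
  finally have "ennreal c * emeasure lebesgue E \<le> perimeter E"
    using fin c E(1) by (simp add: ennreal_mult emeasure_eq_ennreal_measure)
  then have "ennreal c * emeasure lebesgue E / emeasure lebesgue E \<le> perimeter E / emeasure lebesgue E"
    by (rule divide_right_mono_ennreal)
  moreover have "ennreal c * emeasure lebesgue E / emeasure lebesgue E = ennreal c"
    using E(1,3) fin by (intro mult_divide_eq_ennreal) auto
  ultimately show "ennreal c \<le> perimeter E / emeasure lebesgue E" by simp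
qed

text \<open>In a slab of half-width \<open>w\<close> the field \<open>sin (s / w) \<nu>\<close>, where \<open>s\<close> is the coordinate in the direction
  \<open>\<nu>\<close> across the slab, has norm at most \<open>1\<close> everywhere and divergence at least \<open>cos 1 / w \<ge> 1 / (2 w)\<close>
  inside. Multiplication by a bump of radius \<open>n\<close> gives it compact support. On the bounded set
  \<open>\<Omega>\<close> the bump is at least \<open>exp (- 4 / 3)\<close>, its value at distance \<open>n / 2\<close> from the origin, and its
  gradient is of order \<open>1 / n\<close>, so that for large \<open>n\<close> it costs at most half of the divergence.\<close>

lemma cheeger_ge_of_slab:
  fixes \<Omega> :: "'a::euclidean_space set"
  assumes "bounded \<Omega>" and w: "w > 0" and \<nu>: "norm \<nu> = 1"
    and slab: "\<And>x. x \<in> \<Omega> \<Longrightarrow> \<bar>(x - x0) \<bullet> \<nu>\<bar> \<le> w"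
  shows "ennreal (exp (- (4/3)) / (4 * w)) \<le> cheeger_constant \<Omega>"
proof -
  define \<beta> :: real where "\<beta> = exp (- (4/3))"
  obtain D where D: "\<And>x::'a. (bump has_derivative D x) (at x)" "\<And>b. (\<lambda>x. D x b) \<in> smooth_fns"
    using smooth_fns_derivative[OF bump_smooth] by blast
  have D_eq: "D x = frechet_derivative bump (at x)" for x
    using frechet_derivative_eqI[OF D(1)] by simp
  have Dc: "continuous_on UNIV (\<lambda>x. D x \<nu>)"
    using smooth_fns_Ck[OF D(2), of 0] by simp
  have "bounded ((\<lambda>x. D x \<nu>) ` cball 0 1)"
    by (intro compact_imp_bounded compact_continuous_image continuous_on_subset[OF Dc]) auto
  then obtain G0 where "\<forall>y\<in>(\<lambda>x. D x \<nu>) ` cball 0 1. norm y \<le> G0"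
    unfolding bounded_iff by blast
  then have G0: "\<And>x. x \<in> cball 0 1 \<Longrightarrow> \<bar>D x \<nu>\<bar> \<le> G0" by auto
  define G where "G = max 0 G0"
  have G: "\<bar>D x \<nu>\<bar> \<le> G" for x
    using G0[of x] frechet_derivative_off_support[of x bump]
    by (cases "x \<in> cball 0 1") (auto simp: G_def support_bump D_eq)
  obtain R where R: "\<And>x. x \<in> closure \<Omega> \<Longrightarrow> norm x \<le> R"
    using bounded_closure[OF assms(1)] by (auto simp: bounded_iff)
  define n where "n = 1 + 2 * \<bar>R\<bar> + 4 * w * G / \<beta>"
  have \<beta>: "\<beta> > 0" by (simp add: \<beta>_def)
  have G_nonneg: "G \<ge> 0" by (simp add: G_def)
  have n: "n > 0" "2 * \<bar>R\<bar> \<le> n" "4 * w * G / \<beta> \<le> n"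
    unfolding n_def using w \<beta> G_nonneg by (auto intro: add_pos_nonneg)
  define \<theta> where "\<theta> x = x \<bullet> ((1 / w) *\<^sub>R \<nu>) + (- (x0 \<bullet> \<nu>) / w)" for x
  define s where "s x = sin (\<theta> x) * bump ((1 / n) *\<^sub>R (x - 0))" for x
  have s_smooth: "s \<in> smooth_fns"
    unfolding s_def[abs_def] \<theta>_def[abs_def] by (intro smooth_fns.intros smooth_fns_bump_affine)
  have s_der: "(s has_derivative (\<lambda>h. sin (\<theta> x) * D ((1 / n) *\<^sub>R x) ((1 / n) *\<^sub>R h)
      + cos (\<theta> x) * (h \<bullet> ((1 / w) *\<^sub>R \<nu>)) * bump ((1 / n) *\<^sub>R x))) (at x)" for x
  proof -
    have 1: "(\<theta> has_derivative (\<lambda>h. h \<bullet> ((1 / w) *\<^sub>R \<nu>))) (at x)"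
      unfolding \<theta>_def[abs_def] using w by (auto intro!: derivative_eq_intros)
    have 2: "((\<lambda>x. sin (\<theta> x)) has_derivative (\<lambda>h. cos (\<theta> x) * (h \<bullet> ((1 / w) *\<^sub>R \<nu>)))) (at x)"
      using has_derivative_compose[OF 1 DERIV_sin[unfolded has_field_derivative_def]] .
    have 3: "((\<lambda>x. (1 / n) *\<^sub>R x) has_derivative (\<lambda>h. (1 / n) *\<^sub>R h)) (at x)"
      by (auto intro!: derivative_eq_intros)
    have 4: "((\<lambda>x. bump ((1 / n) *\<^sub>R x)) has_derivative (\<lambda>h. D ((1 / n) *\<^sub>R x) ((1 / n) *\<^sub>R h))) (at x)"
      using has_derivative_compose[OF 3 D(1)] .
    show ?thesis
      using has_derivative_mult[OF 2 4] by (simp add: s_def[abs_def])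
  qed
  have D_scale: "D y ((1 / n) *\<^sub>R h) = D y h / n" for y h
    using has_derivative_bounded_linear[OF D(1)[of y]] by (simp add: bounded_linear.linear linear_cmul)
  show ?thesis
    unfolding \<beta>_def[symmetric]
  proof (rule cheeger_ge_of_divergence[where \<phi>="\<lambda>x. s x *\<^sub>R \<nu>"])
    show "Ck 1 (\<lambda>x. s x *\<^sub>R \<nu>)"
      using Ck_1_scaleR_const[of s \<nu>] smooth_fns_Ck[OF s_smooth] by simp
    have "{x. s x *\<^sub>R \<nu> \<noteq> 0} \<subseteq> cball 0 n"
      using n by (auto simp: s_def bump_nonzero_iff)
    then have "support (\<lambda>x. s x *\<^sub>R \<nu>) \<subseteq> cball 0 n"
      unfolding support_def by (intro closure_minimal) auto
    then show "compact (support (\<lambda>x. s x *\<^sub>R \<nu>))"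
      using bounded_subset[OF bounded_cball] by (auto simp: compact_eq_bounded_closed support_def)
    show "norm (s x *\<^sub>R \<nu>) \<le> 1" for x
      using \<nu> mult_mono[OF abs_sin_le_one[of "\<theta> x"] bump_le_1[of "(1 / n) *\<^sub>R x"]] bump_nonneg[of "(1 / n) *\<^sub>R x"]
      by (simp add: s_def abs_mult)
    fix x assume x: "x \<in> closure \<Omega>"
    have "closure \<Omega> \<subseteq> {x. \<bar>(x - x0) \<bullet> \<nu>\<bar> \<le> w}"
    proof (rule closure_minimal)
      show "closed {x. \<bar>(x - x0) \<bullet> \<nu>\<bar> \<le> w}" by (intro closed_Collect_le continuous_intros)
    qed (use slab in auto)
    then have "\<bar>(x - x0) \<bullet> \<nu>\<bar> \<le> w" using x by auto
    moreover have "\<theta> x = ((x - x0) \<bullet> \<nu>) / w" by (simp add: \<theta>_def inner_diff_left diff_divide_distrib)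
    ultimately have "\<bar>\<theta> x\<bar> \<le> 1" using w by simp
    then have "cos (pi / 3) \<le> cos \<bar>\<theta> x\<bar>"
      using pi_gt3 by (intro cos_monotone_0_pi_le) auto
    then have cos: "1 / 2 \<le> cos (\<theta> x)" by (simp add: cos_60)
    have bump: "\<beta> \<le> bump ((1 / n) *\<^sub>R x)"
    proof -
      have "norm ((1 / n) *\<^sub>R x) \<le> 1 / 2" using R[OF x] n by (simp add: field_simps)
      then have "(norm ((1 / n) *\<^sub>R x))\<^sup>2 \<le> (1 / 2)\<^sup>2" by (intro power_mono) auto
      then have r: "3 / 4 \<le> 1 - ((1 / n) *\<^sub>R x) \<bullet> ((1 / n) *\<^sub>R x)"
        by (simp only: power2_norm_eq_inner) (simp add: power2_eq_square)
      define q where "q = 1 - ((1 / n) *\<^sub>R x) \<bullet> ((1 / n) *\<^sub>R x)"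
      have "q \<ge> 3 / 4" using r by (simp only: q_def)
      then have "1 / q \<le> 4 / 3" "q > 0" by (auto simp: field_simps)
      then show ?thesis unfolding bump_def flat_def \<beta>_def q_def[symmetric] by simp
    qed
    have "divergence (\<lambda>x. s x *\<^sub>R \<nu>) x = sin (\<theta> x) * (D ((1 / n) *\<^sub>R x) \<nu> / n) + cos (\<theta> x) / w * bump ((1 / n) *\<^sub>R x)"
      unfolding divergence_scaleR_const[OF s_der] D_scale
      using \<nu> by (simp add: dot_square_norm)
    moreover have "\<bar>sin (\<theta> x) * (D ((1 / n) *\<^sub>R x) \<nu> / n)\<bar> \<le> 1 * (G / n)"
      unfolding abs_mult using n G by (intro mult_mono) (auto simp: abs_divide divide_right_mono)
    moreover have "G / n \<le> \<beta> / (4 * w)"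
      using n w \<beta> by (simp add: field_simps)
    moreover have "1 / 2 / w * \<beta> \<le> cos (\<theta> x) / w * bump ((1 / n) *\<^sub>R x)"
      using cos bump w \<beta> by (intro mult_mono divide_right_mono) auto
    moreover have "1 / 2 / w * \<beta> = 2 * (\<beta> / (4 * w))" by simp
    ultimately show "\<beta> / (4 * w) \<le> divergence (\<lambda>x. s x *\<^sub>R \<nu>) x"
      by linarith
  qed (use assms \<beta> w in auto)
qed

section \<open>Inradius and width\<close>

lemma compact_rows:
  fixes K :: "(real ^ 'm) set"
  assumes "compact K"
  shows "compact {A :: real ^ 'm ^ 'n. \<forall>i. A $ i \<in> K}"
proof -
  obtain B where B: "\<And>x. x \<in> K \<Longrightarrow> norm x \<le> B"
    using compact_imp_bounded[OF assms] by (auto simp: bounded_iff)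
  have "norm A \<le> real CARD('n) * B" if "\<forall>i. A $ i \<in> K" for A :: "real ^ 'm ^ 'n"
  proof -
    have "norm A \<le> (\<Sum>i\<in>UNIV. norm (A $ i))"
      unfolding norm_vec_def by (rule L2_set_le_sum) simp
    also have "\<dots> \<le> (\<Sum>i\<in>(UNIV::'n set). B)" by (intro sum_mono B) (use that in auto)
    finally show ?thesis by simp
  qed
  then have "bounded {A :: real ^ 'm ^ 'n. \<forall>i. A $ i \<in> K}" by (auto simp: bounded_iff)
  moreover have "closed {A :: real ^ 'm ^ 'n. A $ i \<in> K}" for i
    using continuous_closed_vimage[OF compact_imp_closed[OF assms], of "\<lambda>A::real ^ 'm ^ 'n. A $ i"]
    by (auto simp: vimage_def continuous_component)
  then have "closed {A :: real ^ 'm ^ 'n. \<forall>i. A $ i \<in> K}" by (intro closed_Collect_all)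
  ultimately show ?thesis by (simp add: compact_eq_bounded_closed)
qed

lemma continuous_on_det: "continuous_on S (det :: real ^ 'n ^ 'n \<Rightarrow> real)"
  unfolding det_def by (intro continuous_intros)

lemma convex_subunit_combination:
  assumes "convex K" "0 \<in> K" "finite I" "\<And>i. i \<in> I \<Longrightarrow> c i \<ge> 0" "(\<Sum>i\<in>I. c i) \<le> 1" "\<And>i. i \<in> I \<Longrightarrow> x i \<in> K"
  shows "(\<Sum>i\<in>I. c i *\<^sub>R x i) \<in> K"
proof (cases "(\<Sum>i\<in>I. c i) = 0")
  case True
  then have "\<forall>i\<in>I. c i = 0" using assms by (simp add: sum_nonneg_eq_0_iff)
  then show ?thesis using assms(2) by simp
next
  case False
  define s where "s = (\<Sum>i\<in>I. c i)"
  have s: "s > 0" "s \<le> 1" using False assms sum_nonneg[of I c] by (auto simp: s_def)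
  have "(\<Sum>i\<in>I. (c i / s) *\<^sub>R x i) \<in> K"
    by (rule convex_sum) (use assms s in \<open>auto simp: s_def sum_divide_distrib[symmetric]\<close>)
  then have "s *\<^sub>R (\<Sum>i\<in>I. (c i / s) *\<^sub>R x i) + (1 - s) *\<^sub>R 0 \<in> K"
    using assms s by (intro convexD) auto
  then show ?thesis using s by (simp add: scaleR_sum_right)
qed

text \<open>The width of a convex set is bounded by a dimensional multiple of its inradius. Fix a point \<open>z\<close> of
  \<open>\<Omega>\<close> and choose \<open>N\<close> points of its closure that span, together with \<open>z\<close>, a simplex of maximal
  volume. Replacing one of them by \<open>x\<close> multiplies the volume by the corresponding coordinate of
  \<open>x\<close> with respect to the simplex (Cramer's rule), so by maximality all coordinates
  are at most \<open>1\<close> in modulus on \<open>\<Omega>\<close>. The coordinate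
  functional with the largest gradient, of norm \<open>\<alpha>\<close>, thus confines \<open>\<Omega>\<close> to a slab of half-width
  \<open>1 / \<alpha>\<close>, while the simplex contains a ball of radius \<open>1 / (2 N \<alpha>)\<close>.\<close>

lemma inball_and_slab:
  fixes \<Omega> :: "(real ^ 'n) set"
  assumes "open \<Omega>" "bounded \<Omega>" "convex \<Omega>" "\<Omega> \<noteq> {}"
  obtains p \<rho> z \<nu> where "\<rho> > 0" "ball p \<rho> \<subseteq> \<Omega>" "norm \<nu> = 1"
    "\<And>x. x \<in> \<Omega> \<Longrightarrow> \<bar>(x - z) \<bullet> \<nu>\<bar> \<le> 2 * real CARD('n) * \<rho>"
proof -
  define N where "N = real CARD('n)"
  have N: "N > 0" by (simp add: N_def)
  obtain z where z: "z \<in> \<Omega>" using assms by auto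
  define K where "K = (\<lambda>x. x - z) ` closure \<Omega>"
  have K_iff: "y \<in> K \<longleftrightarrow> y + z \<in> closure \<Omega>" for y
    unfolding K_def by (auto intro!: image_eqI[of _ _ "y + z"])
  have K: "compact K" "convex K" "0 \<in> K"
    using assms z closure_subset[of \<Omega>] unfolding K_def
    by (auto intro!: compact_continuous_image continuous_intros convex_translation_subtract convex_closure
        simp: compact_closure)
  define S where "S = {A :: real ^ 'n ^ 'n. \<forall>i. A $ i \<in> K}"
  obtain e where e: "e > 0" "ball z e \<subseteq> \<Omega>" using assms z openE by metis
  define A0 :: "real ^ 'n ^ 'n" where "A0 = (\<chi> i. (e / 2) *\<^sub>R axis i 1)"
  have A0: "A0 \<in> S"
    unfolding S_def A0_def using e closure_subset[of \<Omega>]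
    by (auto simp: K_iff subset_iff dist_norm)
  have det0: "det A0 \<noteq> 0"
    by (subst det_diagonal) (use e in \<open>auto simp: A0_def axis_def\<close>)
  obtain A where A: "A \<in> S" and A_max: "\<And>X. X \<in> S \<Longrightarrow> \<bar>det X\<bar> \<le> \<bar>det A\<bar>"
    using continuous_attains_sup[of S "\<lambda>X. \<bar>det X\<bar>"] A0 compact_rows[OF K(1)] continuous_on_det[of S]
    by (metis S_def empty_iff continuous_on_rabs)
  have det: "det A \<noteq> 0" using A_max[OF A0] det0 by auto
  then obtain B where B: "transpose A ** B = mat 1" "B ** transpose A = mat 1"
    using invertible_det_nz[of "transpose A"] by (auto simp: invertible_def)
  \<comment> \<open>The functional that gives the i-th coordinate with respect to the rows of A.\<close>
  define a where "a i = B $ i" for i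
  have Bv: "(B *v y) $ i = a i \<bullet> y" for y i
    by (simp add: a_def matrix_vector_mul_component)
  have repr: "y = (\<Sum>i\<in>UNIV. (a i \<bullet> y) *\<^sub>R A $ i)" for y
  proof -
    have "y = transpose A *v (B *v y)" by (simp add: matrix_vector_mul_assoc B)
    also have "\<dots> = (\<Sum>i\<in>UNIV. (B *v y) $ i *s column i (transpose A))" by (rule matrix_mult_sum)
    finally show ?thesis by (simp add: Bv row_def scalar_mult_eq_scaleR vec_lambda_eta)
  qed
  have bound: "\<bar>a i \<bullet> y\<bar> \<le> 1" if "y \<in> K" for i y
  proof -
    have "det (\<chi> k. if k = i then y else row k A) = (a i \<bullet> y) * det A"
    proof -
      have combination: "(\<Sum>i\<in>UNIV. (B *v y) $ i *s row i A) = y"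
        using repr[of y] by (simp add: Bv row_def scalar_mult_eq_scaleR vec_lambda_eta)
      show ?thesis
        using cramer_lemma_transpose[of i "B *v y" A] unfolding combination by (simp add: Bv)
    qed
    moreover have "(\<chi> k. if k = i then y else row k A) \<in> S"
      using A that by (auto simp: S_def row_def vec_lambda_eta)
    ultimately have "\<bar>a i \<bullet> y\<bar> * \<bar>det A\<bar> \<le> 1 * \<bar>det A\<bar>"
      using A_max by (metis abs_mult mult_1)
    then show ?thesis using det by simp
  qed
  define \<alpha> where "\<alpha> = Max (range (\<lambda>i. norm (a i)))"
  have \<alpha>_ge: "norm (a i) \<le> \<alpha>" for i unfolding \<alpha>_def by (intro Max_ge) auto
  have "\<alpha> \<in> range (\<lambda>i. norm (a i))" unfolding \<alpha>_def by (intro Max_in) auto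
  then obtain m where m: "\<alpha> = norm (a m)" by auto
  have "\<alpha> > 0"
  proof (rule ccontr)
    assume "\<not> \<alpha> > 0"
    then have "a i = 0" for i using \<alpha>_ge[of i] norm_ge_zero[of "a i"] by (metis linorder_not_le norm_le_zero_iff order_trans)
    then have "axis m 1 = (0 :: real ^ 'n)" using repr[of "axis m 1"] by simp
    then show False by (simp add: axis_eq_0_iff)
  qed
  define \<rho> where "\<rho> = 1 / (2 * N * \<alpha>)"
  have \<rho>: "\<rho> > 0" "\<alpha> * \<rho> = 1 / (2 * N)" "1 / \<alpha> = 2 * N * \<rho>" using N \<open>\<alpha> > 0\<close> by (auto simp: \<rho>_def)
  \<comment> \<open>The point all of whose coordinates are 1 / (2 N): a change of each by at most 1 / (2 N) keeps them nonnegative with sum at most 1.\<close>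
  define q where "q = transpose A *v (\<chi> i. 1 / (2 * N))"
  have aq: "a i \<bullet> q = 1 / (2 * N)" for i
    unfolding Bv[symmetric] q_def matrix_vector_mul_assoc B by simp
  have "ball (q + z) \<rho> \<subseteq> closure \<Omega>"
  proof
    fix x assume "x \<in> ball (q + z) \<rho>"
    define y where "y = x - z"
    have y: "norm (y - q) < \<rho>" using \<open>x \<in> ball (q + z) \<rho>\<close>
      by (simp add: y_def dist_norm norm_minus_commute algebra_simps)
    have c: "\<bar>a i \<bullet> y - 1 / (2 * N)\<bar> \<le> 1 / (2 * N)" for i
    proof -
      have "\<bar>a i \<bullet> y - 1 / (2 * N)\<bar> = \<bar>a i \<bullet> (y - q)\<bar>" by (simp add: inner_diff_right aq)
      also have "\<dots> \<le> norm (a i) * norm (y - q)" by (rule Cauchy_Schwarz_ineq2)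
      also have "\<dots> \<le> \<alpha> * \<rho>" using \<alpha>_ge[of i] y \<open>\<alpha> > 0\<close> by (intro mult_mono) auto
      finally show ?thesis by (simp add: \<rho>)
    qed
    have "(\<Sum>i\<in>UNIV. (a i \<bullet> y) *\<^sub>R A $ i) \<in> K"
    proof (rule convex_subunit_combination[OF K(2,3)])
      show "a i \<bullet> y \<ge> 0" for i using c[of i] by linarith
      have "(\<Sum>i\<in>(UNIV::'n set). a i \<bullet> y) \<le> (\<Sum>i\<in>(UNIV::'n set). 1 / N)"
      proof (rule sum_mono)
        fix i show "a i \<bullet> y \<le> 1 / N" using c[of i] by (simp add: abs_le_iff)
      qed
      then show "(\<Sum>i\<in>(UNIV::'n set). a i \<bullet> y) \<le> 1" using N by (simp add: N_def)
      show "A $ i \<in> K" for i using A by (simp add: S_def)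
    qed simp
    then have "y \<in> K" using repr[of y] by simp
    then show "x \<in> closure \<Omega>" by (simp add: K_iff y_def)
  qed
  then have "ball (q + z) \<rho> \<subseteq> interior (closure \<Omega>)" by (rule interior_maximal) simp
  then have ball: "ball (q + z) \<rho> \<subseteq> \<Omega>"
    using assms by (simp add: convex_interior_closure interior_open)
  define \<nu> where "\<nu> = (1 / \<alpha>) *\<^sub>R a m"
  have \<nu>: "norm \<nu> = 1" using \<open>\<alpha> > 0\<close> m by (simp add: \<nu>_def)
  have "\<bar>(x - z) \<bullet> \<nu>\<bar> \<le> 2 * N * \<rho>" if "x \<in> \<Omega>" for x
  proof -
    have "x - z \<in> K" using that closure_subset[of \<Omega>] by (auto simp: K_iff)
    from bound[OF this, of m] have "\<bar>(x - z) \<bullet> \<nu>\<bar> \<le> 1 / \<alpha>"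
      using \<open>\<alpha> > 0\<close> by (simp add: \<nu>_def inner_commute abs_mult divide_right_mono)
    then show ?thesis by (simp add: \<rho>)
  qed
  then show ?thesis unfolding N_def by (rule that[OF \<rho>(1) ball \<nu>])
qed

section \<open>Compactness of sublevels up to similarity\<close>

lemma ennreal_powr_mono: "x \<le> y \<Longrightarrow> a \<ge> 0 \<Longrightarrow> ennreal_powr x a \<le> ennreal_powr y a"
  by (auto simp: ennreal_powr_def top_unique less_top intro!: ennreal_leI powr_mono2 enn2real_mono)

lemma ennreal_powr_ennreal: "r \<ge> 0 \<Longrightarrow> ennreal_powr (ennreal r) a = ennreal (r powr a)"
  by (simp add: ennreal_powr_def)

lemma ennreal_powr_mult:
  assumes "c > 0"
  shows "ennreal_powr (ennreal c * x) a = ennreal (c powr a) * ennreal_powr x a"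
proof (cases x)
  case (real r)
  then show ?thesis using assms
    by (simp add: ennreal_powr_ennreal ennreal_mult[symmetric] powr_mult)
next
  case top
  then show ?thesis using assms by (simp add: ennreal_powr_def ennreal_mult_top)
qed

text \<open>The only property of the functional used to pass to a limit: it changes little between sets that
  almost contain each other. For \<open>s = 1 / t\<close> it contains the invariance under similarities. The exponent
  \<open>1 / (N + 2)\<close> turns the factor \<open>t\<^sup>N\<^sup>+\<^sup>2\<close> of the rigidity into \<open>t\<close>.\<close>

lemma torsion_cheeger_le_of_subsets:
  fixes \<Omega> \<Omega>' :: "(real ^ 'n) set"
  assumes "open \<Omega>" "bounded \<Omega>" "open \<Omega>'" and t: "t > 0" and s: "s > 0"
    and sub: "\<Omega> \<subseteq> (\<lambda>x. a + t *\<^sub>R x) ` \<Omega>'" and sub': "\<Omega>' \<subseteq> (\<lambda>x. b + s *\<^sub>R x) ` \<Omega>"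
  shows "torsion_cheeger \<Omega> \<le> ennreal (t * s) * torsion_cheeger \<Omega>'"
proof -
  define N where "N = CARD('n)"
  define T where "T = ennreal_powr (torsional_rigidity \<Omega>') (1 / (real N + 2))"
  have "ennreal_powr (torsional_rigidity \<Omega>) (1 / (real N + 2))
      \<le> ennreal_powr (ennreal (t ^ (N + 2)) * torsional_rigidity \<Omega>') (1 / (real N + 2))"
    using torsion_le_of_subset_affine[OF assms(1-3) t sub] by (intro ennreal_powr_mono) (auto simp: N_def)
  also have "\<dots> = ennreal ((t ^ (N + 2)) powr (1 / (real N + 2))) * T"
    unfolding T_def using t by (intro ennreal_powr_mult) simp
  also have "(t ^ (N + 2)) powr (1 / (real N + 2)) = t"
  proof -
    have "t ^ (N + 2) = t powr real (N + 2)" by (rule powr_realpow[OF t, symmetric])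
    moreover have "real (N + 2) * (1 / (real N + 2)) = 1" by (simp add: field_simps)
    ultimately show ?thesis using t by (simp only: powr_powr powr_one)
  qed
  finally have "torsion_cheeger \<Omega> \<le> (ennreal t * T) * (ennreal s * cheeger_constant \<Omega>')"
    unfolding torsion_cheeger_def N_def[symmetric]
    by (intro mult_mono cheeger_le_of_subset_affine[OF s sub']) auto
  also have "\<dots> = ennreal (t * s) * torsion_cheeger \<Omega>'"
    unfolding torsion_cheeger_def N_def[symmetric] T_def using t s by (simp add: ennreal_mult mult_ac)
  finally show ?thesis .
qed

text \<open>The convex hull of a ball and a point \<open>p\<close> contains, around each point of the first half of the segment
  from the centre to \<open>p\<close>, a ball of half the radius. Such balls centred at distance \<open>2\<close> from each other
  fit in a number proportional to the length of \<open>p\<close>.\<close>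

lemma disjoint_balls_towards_point:
  fixes \<Omega> :: "'a::euclidean_space set"
  assumes "convex \<Omega>" and ball: "ball 0 4 \<subseteq> \<Omega>" and p: "p \<in> \<Omega>" "4 * real k \<le> norm p" and k: "k > 0"
  obtains a where "\<And>i. i < k \<Longrightarrow> cball (a i) 1 \<subseteq> \<Omega>"
    "\<And>i j. i < k \<Longrightarrow> j < k \<Longrightarrow> i \<noteq> j \<Longrightarrow> dist (a i) (a j) \<ge> 2"
proof -
  have np: "norm p > 0" using p(2) k by (auto intro: less_le_trans)
  define a where "a i = (2 * real i / norm p) *\<^sub>R p" for i :: nat
  show ?thesis
  proof (rule that[of a])
    fix i assume "i < k"
    define s where "s = 2 * real i / norm p"
    have "2 * real i \<le> norm p / 2" using \<open>i < k\<close> p(2) by simp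
    then have s: "0 \<le> s" "s \<le> 1 / 2" using np by (auto simp: s_def field_simps)
    show "cball (a i) 1 \<subseteq> \<Omega>"
    proof
      fix y assume y: "y \<in> cball (a i) 1"
      define y' where "y' = (1 / (1 - s)) *\<^sub>R (y - s *\<^sub>R p)"
      have "norm (y - s *\<^sub>R p) \<le> 1" using y by (simp add: a_def s_def dist_norm norm_minus_commute)
      then have "norm y' \<le> 1 / (1 - s)" using s by (simp add: y'_def divide_right_mono)
      also have "\<dots> \<le> 2" using s by (simp add: field_simps)
      finally have "y' \<in> \<Omega>" using ball by (auto simp: subset_iff)
      then have "s *\<^sub>R p + (1 - s) *\<^sub>R y' \<in> \<Omega>"
        using \<open>convex \<Omega>\<close> p s by (intro convexD) auto
      then show "y \<in> \<Omega>" using s by (simp add: y'_def)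
    qed
  next
    fix i j assume "i \<noteq> (j::nat)"
    have "a i - a j = ((2 * real i - 2 * real j) / norm p) *\<^sub>R p"
      by (simp add: a_def scaleR_diff_left[symmetric] diff_divide_distrib)
    then have "dist (a i) (a j) = \<bar>2 * real i - 2 * real j\<bar>"
      using np by (simp add: dist_norm)
    also have "\<dots> \<ge> 2" using \<open>i \<noteq> j\<close> by (auto simp: abs_if)
    finally show "dist (a i) (a j) \<ge> 2" .
  qed
qed

text \<open>Compactness of sublevels modulo similarities. After a similarity, the ball of
  \<open>inball_and_slab\<close> has radius \<open>4\<close> and is centred at the origin; then the width is at most \<open>16 N\<close> and
  the Cheeger constant is bounded below. If \<open>\<Omega>\<close> reached far out, it would contain many disjoint
  unit balls, and its rigidity would push the functional above \<open>M\<close>.\<close>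

lemma normalized_competitor:
  fixes M :: real
  assumes M: "M \<ge> 0"
  shows "\<exists>R>0. \<forall>\<Omega> :: (real ^ 'n) set. open \<Omega> \<and> bounded \<Omega> \<and> convex \<Omega> \<and> \<Omega> \<noteq> {} \<and> torsion_cheeger \<Omega> \<le> ennreal M
    \<longrightarrow> (\<exists>\<Omega>' :: (real ^ 'n) set. open \<Omega>' \<and> convex \<Omega>' \<and> ball 0 1 \<subseteq> \<Omega>' \<and> \<Omega>' \<subseteq> ball 0 R \<and> torsion_cheeger \<Omega>' \<le> torsion_cheeger \<Omega>)"
proof -
  define N where "N = real CARD('n)"
  have N: "N > 0" by (simp add: N_def)
  obtain c where c: "c > 0" and torsion: "\<And>(\<Omega>::(real ^ 'n) set) a (k::nat). open \<Omega> \<Longrightarrow> 0 < k \<Longrightarrow>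
     (\<And>i. i < k \<Longrightarrow> cball (a i) 1 \<subseteq> \<Omega>) \<Longrightarrow> (\<And>i j. i < k \<Longrightarrow> j < k \<Longrightarrow> i \<noteq> j \<Longrightarrow> dist (a i) (a j) \<ge> 2) \<Longrightarrow>
     ennreal (c * real k) \<le> torsional_rigidity \<Omega>"
    using torsion_ge_of_disjoint_balls[where 'a="real ^ 'n"] by metis
  define c' where "c' = exp (- (4/3)) / (4 * (8 * N))"
  have c': "c' > 0" using N by (simp add: c'_def)
  define r where "r = (M / c' + 1) powr (N + 2) / c"
  define k where "k = nat \<lceil>r\<rceil> + 1"
  have k: "k > 0" "real k \<ge> r" by (auto simp: k_def) linarith
  have big: "M < (c * real k) powr (1 / (N + 2)) * c'"
  proof -
    have "(M / c' + 1) powr (N + 2) \<le> c * real k"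
      using k(2) c by (simp add: r_def field_simps)
    then have "((M / c' + 1) powr (N + 2)) powr (1 / (N + 2)) \<le> (c * real k) powr (1 / (N + 2))"
      using N by (intro powr_mono2) auto
    moreover have "((M / c' + 1) powr (N + 2)) powr (1 / (N + 2)) = M / c' + 1"
      using N M c' by (simp add: powr_powr add_nonneg_pos)
    ultimately have "M / c' < (c * real k) powr (1 / (N + 2))" by linarith
    then show ?thesis using c' by (simp add: pos_divide_less_eq)
  qed
  show ?thesis
  proof (intro exI[of _ "4 * real k"] conjI allI impI)
    show "0 < 4 * real k" using k by simp
    fix \<Omega> :: "(real ^ 'n) set"
    assume "open \<Omega> \<and> bounded \<Omega> \<and> convex \<Omega> \<and> \<Omega> \<noteq> {} \<and> torsion_cheeger \<Omega> \<le> ennreal M"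
    then have \<Omega>: "open \<Omega>" "bounded \<Omega>" "convex \<Omega>" "\<Omega> \<noteq> {}" and le: "torsion_cheeger \<Omega> \<le> ennreal M" by auto
    obtain p \<rho> z \<nu> where \<rho>: "\<rho> > 0" and ball: "ball p \<rho> \<subseteq> \<Omega>" and \<nu>: "norm \<nu> = 1"
      and slab: "\<And>x. x \<in> \<Omega> \<Longrightarrow> \<bar>(x - z) \<bullet> \<nu>\<bar> \<le> 2 * N * \<rho>"
      using inball_and_slab[OF \<Omega>] unfolding N_def by metis
    define t where "t = 4 / \<rho>"
    have t: "t > 0" using \<rho> by (simp add: t_def)
    define f where "f x = (- t *\<^sub>R p) + t *\<^sub>R x" for x :: "real ^ 'n"
    define \<Omega>' where "\<Omega>' = f ` \<Omega>"
    have inv: "p + (1 / t) *\<^sub>R f x = x" for x using t by (simp add: f_def algebra_simps)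
    have \<Omega>': "open \<Omega>'" "bounded \<Omega>'" "convex \<Omega>'"
    proof -
      have eq: "\<Omega>' = (\<lambda>x. (- t *\<^sub>R p) + x) ` ((\<lambda>x. t *\<^sub>R x) ` \<Omega>)"
        by (simp add: \<Omega>'_def f_def[abs_def] image_image)
      show "open \<Omega>'" "bounded \<Omega>'" "convex \<Omega>'"
        unfolding eq by (intro open_translation open_scaling bounded_translation bounded_scaling
            convex_translation convex_scaling \<Omega>; use t in simp)+
    qed
    have le': "torsion_cheeger \<Omega>' \<le> torsion_cheeger \<Omega>"
      using torsion_cheeger_le_of_subsets[OF \<Omega>'(1,2) \<Omega>(1) t, of "1 / t" "- t *\<^sub>R p" p] t inv
      by (auto simp: \<Omega>'_def f_def[abs_def] image_image)
    have ball': "ball 0 4 \<subseteq> \<Omega>'"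
    proof
      fix y :: "real ^ 'n" assume y: "y \<in> ball 0 4"
      have "p + (1 / t) *\<^sub>R y \<in> ball p \<rho>"
        using y t \<rho> by (simp add: dist_norm t_def field_simps)
      moreover have "y = f (p + (1 / t) *\<^sub>R y)" using t by (simp add: f_def algebra_simps)
      ultimately show "y \<in> \<Omega>'" using ball by (auto simp: \<Omega>'_def)
    qed
    have slab': "\<bar>(y - f z) \<bullet> \<nu>\<bar> \<le> 8 * N" if "y \<in> \<Omega>'" for y
    proof -
      obtain x where x: "x \<in> \<Omega>" "y = f x" using \<open>y \<in> \<Omega>'\<close> unfolding \<Omega>'_def by blast
      have "y - f z = t *\<^sub>R (x - z)" using x by (simp add: f_def algebra_simps)
      then have "\<bar>(y - f z) \<bullet> \<nu>\<bar> = t * \<bar>(x - z) \<bullet> \<nu>\<bar>" using t by (simp add: abs_mult)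
      also have "\<dots> \<le> t * (2 * N * \<rho>)" using slab[OF x(1)] t by (intro mult_left_mono) auto
      also have "\<dots> = 8 * N" using \<rho> by (simp add: t_def)
      finally show ?thesis .
    qed
    have cheeger: "ennreal c' \<le> cheeger_constant \<Omega>'"
      unfolding c'_def by (rule cheeger_ge_of_slab[OF \<Omega>'(2) _ \<nu> slab']) (use N in auto)
    have outer: "\<Omega>' \<subseteq> ball 0 (4 * real k)"
    proof (rule ccontr)
      assume "\<not> \<Omega>' \<subseteq> ball 0 (4 * real k)"
      then obtain q where q: "q \<in> \<Omega>'" "4 * real k \<le> norm q" by (auto simp: subset_iff not_less)
      obtain a where "\<And>i. i < k \<Longrightarrow> cball (a i) 1 \<subseteq> \<Omega>'"
        "\<And>i j. i < k \<Longrightarrow> j < k \<Longrightarrow> i \<noteq> j \<Longrightarrow> dist (a i) (a j) \<ge> 2"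
        using disjoint_balls_towards_point[OF \<Omega>'(3) ball' q k(1)] by metis
      then have "ennreal (c * real k) \<le> torsional_rigidity \<Omega>'"
        using torsion[OF \<Omega>'(1) k(1)] by blast
      then have "ennreal ((c * real k) powr (1 / (N + 2))) \<le> ennreal_powr (torsional_rigidity \<Omega>') (1 / (N + 2))"
        using ennreal_powr_mono[of "ennreal (c * real k)" _ "1 / (N + 2)"] c N by (simp add: ennreal_powr_ennreal)
      then have "ennreal ((c * real k) powr (1 / (N + 2))) * ennreal c' \<le> torsion_cheeger \<Omega>'"
        unfolding torsion_cheeger_def N_def using cheeger by (intro mult_mono) auto
      also have "\<dots> \<le> ennreal M" using le le' by simp
      finally have "(c * real k) powr (1 / (N + 2)) * c' \<le> M"
        using c' M by (simp add: ennreal_mult'[symmetric])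
      then show False using big by simp
    qed
    have inner: "ball 0 1 \<subseteq> \<Omega>'" using ball' by (auto simp: subset_iff)
    show "\<exists>\<Omega>' :: (real ^ 'n) set. open \<Omega>' \<and> convex \<Omega>' \<and> ball 0 1 \<subseteq> \<Omega>' \<and> \<Omega>' \<subseteq> ball 0 (4 * real k) \<and> torsion_cheeger \<Omega>' \<le> torsion_cheeger \<Omega>"
      by (intro exI[of _ \<Omega>'] conjI \<Omega>'(1,3) inner outer le')
  qed
qed

section \<open>A selection theorem for convex bodies\<close>

text \<open>The gauge of a convex set. Gauges serve as coordinates on the space of convex bodies: they are
  uniformly Lipschitz, so the Arzela-Ascoli theorem applies, and uniform closeness of gauges means
  inclusion up to a small dilation.\<close>

definition minkowski :: "'a::real_vector set \<Rightarrow> 'a \<Rightarrow> real" where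
  "minkowski \<Omega> x = Inf {t. t > 0 \<and> (1 / t) *\<^sub>R x \<in> \<Omega>}"

locale pinched_body =
  fixes \<Omega> :: "'a::euclidean_space set" and R :: real
  assumes open_body: "open \<Omega>" and convex_body: "convex \<Omega>"
    and inner_ball: "ball 0 1 \<subseteq> \<Omega>" and outer_ball: "\<Omega> \<subseteq> ball 0 R"
begin

lemma zero_in_body: "0 \<in> \<Omega>"
  using inner_ball by auto

lemma minkowski_le: "t > 0 \<Longrightarrow> (1 / t) *\<^sub>R x \<in> \<Omega> \<Longrightarrow> minkowski \<Omega> x \<le> t"
  unfolding minkowski_def by (intro cInf_lower bdd_belowI[of _ 0]) auto

lemma minkowski_le_norm: "minkowski \<Omega> x \<le> norm x"
proof (rule field_le_epsilon)
  fix e :: real assume e: "e > 0"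
  then have t: "norm x + e > 0" by (simp add: add_nonneg_pos)
  have "(1 / (norm x + e)) *\<^sub>R x \<in> \<Omega>"
    using t e inner_ball by (auto simp: subset_iff)
  then show "minkowski \<Omega> x \<le> norm x + e" by (rule minkowski_le[OF t])
qed

lemma minkowski_nonneg: "0 \<le> minkowski \<Omega> x"
  unfolding minkowski_def
proof (rule cInf_greatest)
  have "(1 / (norm x + 1)) *\<^sub>R x \<in> \<Omega>"
    using inner_ball by (auto simp: subset_iff add_nonneg_pos)
  then show "{t. t > 0 \<and> (1 / t) *\<^sub>R x \<in> \<Omega>} \<noteq> {}"
    using add_nonneg_pos[OF norm_ge_zero[of x] zero_less_one] by blast
qed auto

lemma in_body_if_minkowski_less:
  assumes "minkowski \<Omega> x < t"
  shows "t > 0" "(1 / t) *\<^sub>R x \<in> \<Omega>"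
proof -
  show t: "t > 0" using assms minkowski_nonneg[of x] by simp
  have "(1 / (norm x + 1)) *\<^sub>R x \<in> \<Omega>"
    using inner_ball by (auto simp: subset_iff add_nonneg_pos)
  then have "{t. t > 0 \<and> (1 / t) *\<^sub>R x \<in> \<Omega>} \<noteq> {}"
    using add_nonneg_pos[OF norm_ge_zero[of x] zero_less_one] by blast
  from cInf_lessD[OF this, of t] obtain s where s: "s > 0" "(1 / s) *\<^sub>R x \<in> \<Omega>" "s < t"
    using assms unfolding minkowski_def by blast
  have "(s / t) *\<^sub>R ((1 / s) *\<^sub>R x) + (1 - s / t) *\<^sub>R 0 \<in> \<Omega>"
    using s t by (intro convexD[OF convex_body]) (auto simp: zero_in_body)
  then show "(1 / t) *\<^sub>R x \<in> \<Omega>" using s by simp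
qed

lemma body_iff_minkowski: "x \<in> \<Omega> \<longleftrightarrow> minkowski \<Omega> x < 1"
proof
  assume "minkowski \<Omega> x < 1"
  from in_body_if_minkowski_less(2)[OF this] show "x \<in> \<Omega>" by simp
next
  assume x: "x \<in> \<Omega>"
  have "open ((\<lambda>s::real. s *\<^sub>R x) -` \<Omega>)"
    by (intro continuous_open_vimage open_body) (auto intro!: continuous_intros)
  moreover have "1 \<in> (\<lambda>s::real. s *\<^sub>R x) -` \<Omega>" using x by simp
  ultimately obtain e where e: "e > 0" "ball 1 e \<subseteq> (\<lambda>s::real. s *\<^sub>R x) -` \<Omega>"
    by (meson openE)
  have "1 + e / 2 \<in> ball 1 e" using e by (simp add: dist_real_def)
  then have "(1 + e / 2) *\<^sub>R x \<in> \<Omega>" using e by blast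
  then have "minkowski \<Omega> x \<le> 1 / (1 + e / 2)"
    using e by (intro minkowski_le) auto
  also have "\<dots> < 1" using e by simp
  finally show "minkowski \<Omega> x < 1" .
qed

lemma minkowski_add: "minkowski \<Omega> (x + y) \<le> minkowski \<Omega> x + minkowski \<Omega> y"
proof (rule field_le_epsilon)
  fix e :: real assume e: "e > 0"
  define t where "t = minkowski \<Omega> x + e / 2"
  define s where "s = minkowski \<Omega> y + e / 2"
  have t: "t > 0" "(1 / t) *\<^sub>R x \<in> \<Omega>" using in_body_if_minkowski_less[of x t] e by (auto simp: t_def)
  have s: "s > 0" "(1 / s) *\<^sub>R y \<in> \<Omega>" using in_body_if_minkowski_less[of y s] e by (auto simp: s_def)
  have "(t / (t + s)) *\<^sub>R ((1 / t) *\<^sub>R x) + (s / (t + s)) *\<^sub>R ((1 / s) *\<^sub>R y) \<in> \<Omega>"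
    using s t by (intro convexD[OF convex_body]) (auto simp: add_divide_distrib[symmetric])
  then have "(1 / (t + s)) *\<^sub>R (x + y) \<in> \<Omega>" using s t by (simp add: scaleR_add_right)
  then have "minkowski \<Omega> (x + y) \<le> t + s" using s t by (intro minkowski_le) auto
  then show "minkowski \<Omega> (x + y) \<le> minkowski \<Omega> x + minkowski \<Omega> y + e" by (simp add: t_def s_def)
qed

lemma minkowski_lipschitz: "\<bar>minkowski \<Omega> x - minkowski \<Omega> y\<bar> \<le> norm (x - y)"
  using minkowski_add[of y "x - y"] minkowski_add[of x "y - x"]
    minkowski_le_norm[of "x - y"] minkowski_le_norm[of "y - x"]
  by (simp add: norm_minus_commute)

lemma minkowski_scaleR_le:
  assumes c: "c > 0"
  shows "minkowski \<Omega> (c *\<^sub>R x) \<le> c * minkowski \<Omega> x"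
proof (rule field_le_epsilon)
  fix e :: real assume e: "e > 0"
  define t where "t = minkowski \<Omega> x + e / c"
  have t: "t > 0" "(1 / t) *\<^sub>R x \<in> \<Omega>"
    using in_body_if_minkowski_less[of x t] e c by (auto simp: t_def)
  then have "minkowski \<Omega> (c *\<^sub>R x) \<le> c * t" using c by (intro minkowski_le) auto
  then show "minkowski \<Omega> (c *\<^sub>R x) \<le> c * minkowski \<Omega> x + e" using c by (simp add: t_def distrib_left)
qed

end

text \<open>A form of Blaschke's selection theorem. The uniform limit \<open>l\<close> of a subsequence of the gauges
  is again positively homogeneous and subadditive, and its strict unit sublevel set is the limit
  body. The limit is only available on a ball, which is why scaling is used by factors that stay inside it.
  Closeness is measured by dilations rather than by the Hausdorff distance, since this is what
  \<open>torsion_cheeger_le_of_subsets\<close> asks for.\<close>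

lemma convex_body_selection:
  fixes \<Omega> :: "nat \<Rightarrow> 'a::euclidean_space set"
  assumes bodies: "\<And>n. pinched_body (\<Omega> n) R"
  obtains L k where "pinched_body L R" "strict_mono (k :: nat \<Rightarrow> nat)"
    "\<forall>e>0. \<exists>n0. \<forall>n\<ge>n0. L \<subseteq> (\<lambda>x. (1 + e) *\<^sub>R x) ` \<Omega> (k n) \<and> \<Omega> (k n) \<subseteq> (\<lambda>x. (1 + e) *\<^sub>R x) ` L"
proof -
  define g where "g n = minkowski (\<Omega> n)" for n
  interpret body: pinched_body "\<Omega> n" R for n by (rule bodies)
  obtain l k where l: "continuous_on (cball 0 R) l" and k: "strict_mono (k :: nat \<Rightarrow> nat)"
    and unif: "\<And>e. 0 < e \<Longrightarrow> \<exists>N. \<forall>n x. n \<ge> N \<and> x \<in> cball 0 R \<longrightarrow> norm (g (k n) x - l x) < e"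
  proof (rule Arzela_Ascoli[of "cball (0::'a) R" g R])
    show "norm (g n x) \<le> R" if "x \<in> cball 0 R" for n x
      using that body.minkowski_le_norm[of n x] body.minkowski_nonneg[of n x] by (simp add: g_def)
    show "\<exists>d>0. \<forall>n y. y \<in> cball 0 R \<and> norm (x - y) < d \<longrightarrow> norm (g n x - g n y) < e"
      if "x \<in> cball 0 R" "0 < e" for x e
      using that body.minkowski_lipschitz by (intro exI[of _ e]) (auto simp: g_def intro: le_less_trans)
  qed auto
  have lim: "(\<lambda>n. g (k n) x) \<longlonglongrightarrow> l x" if "x \<in> cball 0 R" for x
    unfolding LIMSEQ_def dist_norm using unif that by meson
  have l_scaleR: "l (c *\<^sub>R x) \<le> c * l x" if "x \<in> cball 0 R" "c *\<^sub>R x \<in> cball 0 R" "c > 0" for c x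
    using body.minkowski_scaleR_le[OF \<open>c > 0\<close>]
    by (intro LIMSEQ_le[OF lim[OF that(2)] tendsto_mult_left[OF lim[OF that(1)]]]) (auto simp: g_def)
  have l_add: "l (x + y) \<le> l x + l y" if "x \<in> cball 0 R" "y \<in> cball 0 R" "x + y \<in> cball 0 R" for x y
    by (intro LIMSEQ_le[OF lim[OF that(3)] tendsto_add[OF lim[OF that(1)] lim[OF that(2)]]])
      (auto simp: g_def body.minkowski_add)
  have l_le_norm: "l x \<le> norm x" if "x \<in> cball 0 R" for x
    by (intro LIMSEQ_le[OF lim[OF that] tendsto_const]) (auto simp: g_def body.minkowski_le_norm)
  define L where "L = l -` {..<1} \<inter> ball 0 R"
  have R: "ball (0::'a) 1 \<subseteq> ball 0 R" using body.inner_ball body.outer_ball by blast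
  have "pinched_body L R"
  proof
    show "open L" unfolding L_def
      by (intro continuous_on_open_vimage[THEN iffD1, rule_format] continuous_on_subset[OF l]) auto
    show "ball 0 1 \<subseteq> L"
    proof
      fix x :: 'a assume x: "x \<in> ball 0 1"
      then have "x \<in> ball 0 R" using R by blast
      then show "x \<in> L" using x l_le_norm[of x] by (simp add: L_def)
    qed
    show "L \<subseteq> ball 0 R" by (simp add: L_def)
    show "convex L"
    proof (rule convexI)
      fix x y and u v :: real
      assume xy: "x \<in> L" "y \<in> L" and uv: "0 \<le> u" "0 \<le> v" "u + v = 1"
      have zball: "u *\<^sub>R x + v *\<^sub>R y \<in> ball 0 R"
        using xy uv by (intro convexD[OF convex_ball]) (auto simp: L_def)
      show "u *\<^sub>R x + v *\<^sub>R y \<in> L"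
      proof (cases "u = 0 \<or> v = 0")
        case True
        then show ?thesis using xy uv by auto
      next
        case False
        then have pos: "u > 0" "v > 0" using uv by auto
        have sc: "norm (u *\<^sub>R x) \<le> R" "norm (v *\<^sub>R y) \<le> R"
          using xy uv mult_right_mono[of u 1 "norm x"] mult_right_mono[of v 1 "norm y"] by (auto simp: L_def)
        have "l (u *\<^sub>R x + v *\<^sub>R y) \<le> u * l x + v * l y"
          using l_add[of "u *\<^sub>R x" "v *\<^sub>R y"] l_scaleR[of x u] l_scaleR[of y v] xy sc zball pos
          by (simp add: L_def)
        also have "\<dots> < u * 1 + v * 1"
          using xy pos by (intro add_strict_mono mult_strict_left_mono) (auto simp: L_def)
        finally show ?thesis using zball uv by (simp add: L_def)
      qed
    qed
  qed
  moreover have "\<exists>n0. \<forall>n\<ge>n0. L \<subseteq> (\<lambda>x. (1 + e) *\<^sub>R x) ` \<Omega> (k n) \<and> \<Omega> (k n) \<subseteq> (\<lambda>x. (1 + e) *\<^sub>R x) ` L"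
    if e: "e > 0" for e
  proof -
    obtain n0 where n0: "\<And>n x. n \<ge> n0 \<Longrightarrow> x \<in> cball 0 R \<Longrightarrow> norm (g (k n) x - l x) < e"
      using unif[OF e] by blast
    have shrink: "(1 / (1 + e)) *\<^sub>R x \<in> ball 0 R" if "x \<in> ball 0 R" for x :: 'a
    proof -
      have "norm ((1 / (1 + e)) *\<^sub>R x) \<le> norm x" using e by (simp add: field_simps)
      then show ?thesis using that by simp
    qed
    show ?thesis
    proof (intro exI[of _ n0] allI impI conjI subsetI)
      fix n x assume n: "n \<ge> n0" and x: "x \<in> L"
      have "g (k n) x < 1 + e" using n0[OF n, of x] x by (auto simp: L_def)
      then have "(1 / (1 + e)) *\<^sub>R x \<in> \<Omega> (k n)"
        unfolding g_def by (rule body.in_body_if_minkowski_less)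
      then show "x \<in> (\<lambda>x. (1 + e) *\<^sub>R x) ` \<Omega> (k n)"
        using e by (intro image_eqI[of _ _ "(1 / (1 + e)) *\<^sub>R x"]) auto
    next
      fix n x assume n: "n \<ge> n0" and x: "x \<in> \<Omega> (k n)"
      have xb: "x \<in> ball 0 R" using x body.outer_ball by blast
      have "g (k n) x < 1" using x body.body_iff_minkowski unfolding g_def by blast
      then have "l x < 1 + e" using n0[OF n, of x] xb by auto
      moreover have "l ((1 / (1 + e)) *\<^sub>R x) \<le> 1 / (1 + e) * l x"
        using xb shrink[OF xb] e by (intro l_scaleR) auto
      moreover have "1 / (1 + e) * l x < 1" if "l x < 1 + e" using that e by simp
      ultimately have "l ((1 / (1 + e)) *\<^sub>R x) < 1" by linarith
      then have "(1 / (1 + e)) *\<^sub>R x \<in> L" using shrink[OF xb] by (simp add: L_def)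
      then show "x \<in> (\<lambda>x. (1 + e) *\<^sub>R x) ` L"
        using e by (intro image_eqI[of _ _ "(1 / (1 + e)) *\<^sub>R x"]) auto
    qed
  qed
  ultimately show ?thesis using k that by blast
qed

section \<open>Existence of a minimizer\<close>

theorem theorem1p1:
  shows "\<exists>\<Omega>' :: (real ^ 'n) set.
    open \<Omega>' \<and> bounded \<Omega>' \<and> convex \<Omega>' \<and> \<Omega>' \<noteq> {} \<and>
    (\<forall>\<Omega> :: (real ^ 'n) set. open \<Omega> \<and> bounded \<Omega> \<and> convex \<Omega> \<and> \<Omega> \<noteq> {} \<longrightarrow>
       torsion_cheeger \<Omega>' \<le> torsion_cheeger \<Omega>)"
proof -
  define \<A> where "\<A> = {\<Omega> :: (real ^ 'n) set. open \<Omega> \<and> bounded \<Omega> \<and> convex \<Omega> \<and> \<Omega> \<noteq> {}}"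
  define m where "m = (INF \<Omega>\<in>\<A>. torsion_cheeger \<Omega>)"
  have m_le: "m \<le> torsion_cheeger \<Omega>" if "\<Omega> \<in> \<A>" for \<Omega>
    unfolding m_def using that by (rule INF_lower)
  have "\<exists>\<Omega>'\<in>\<A>. torsion_cheeger \<Omega>' \<le> m"
  proof (cases m)
    case top
    \<comment> \<open>If the infimum is infinite, every set is a minimizer.\<close>
    have "ball 0 1 \<in> \<A>" by (simp add: \<A>_def)
    then show ?thesis using top by (intro bexI[of _ "ball 0 1"]) auto
  next
    case (real \<mu>)
    obtain R where "R > 0" and competitor: "\<And>\<Omega> :: (real ^ 'n) set. \<Omega> \<in> \<A> \<Longrightarrow> torsion_cheeger \<Omega> \<le> ennreal (\<mu> + 1) \<Longrightarrow>
      \<exists>\<Omega>' :: (real ^ 'n) set. pinched_body \<Omega>' R \<and> torsion_cheeger \<Omega>' \<le> torsion_cheeger \<Omega>"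
      using normalized_competitor[where 'n='n, of "\<mu> + 1"] real unfolding \<A>_def pinched_body_def by auto
    have "\<exists>\<Omega> :: (real ^ 'n) set. pinched_body \<Omega> R \<and> torsion_cheeger \<Omega> \<le> ennreal (\<mu> + 1 / real (Suc n))" for n
    proof -
      have "m < ennreal (\<mu> + 1 / real (Suc n))" using real by (simp add: ennreal_less_iff)
      then obtain \<Omega> where \<Omega>: "\<Omega> \<in> \<A>" "torsion_cheeger \<Omega> < ennreal (\<mu> + 1 / real (Suc n))"
        unfolding m_def INF_less_iff by blast
      note less_imp_le[OF \<Omega>(2)]
      also have "ennreal (\<mu> + 1 / real (Suc n)) \<le> ennreal (\<mu> + 1)" by (intro ennreal_leI) simp
      finally obtain \<Omega>' :: "(real ^ 'n) set" where "pinched_body \<Omega>' R" "torsion_cheeger \<Omega>' \<le> torsion_cheeger \<Omega>"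
        using competitor[OF \<Omega>(1)] by blast
      then show ?thesis using \<Omega>(2) by (intro exI[of _ \<Omega>']) auto
    qed
    then obtain \<Omega> :: "nat \<Rightarrow> (real ^ 'n) set" where bodies: "\<And>n. pinched_body (\<Omega> n) R"
      and min: "\<And>n. torsion_cheeger (\<Omega> n) \<le> ennreal (\<mu> + 1 / real (Suc n))"
      by metis
    obtain L k where L: "pinched_body L R" and k: "strict_mono (k :: nat \<Rightarrow> nat)"
      and conv: "\<forall>e>0. \<exists>n0. \<forall>n\<ge>n0. L \<subseteq> (\<lambda>x. (1 + e) *\<^sub>R x) ` \<Omega> (k n) \<and> \<Omega> (k n) \<subseteq> (\<lambda>x. (1 + e) *\<^sub>R x) ` L"
      by (rule convex_body_selection[of \<Omega> R, OF bodies])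
    have L': "open L" "bounded L" "convex L" "L \<noteq> {}"
      using L bounded_subset[OF bounded_ball pinched_body.outer_ball[OF L]] pinched_body.zero_in_body[OF L]
      unfolding pinched_body_def by auto
    have bound: "torsion_cheeger L \<le> ennreal ((1 + e) * (1 + e) * (\<mu> + e))" if e: "e > 0" for e
    proof -
      obtain n0 where n0: "\<And>n. n \<ge> n0 \<Longrightarrow> L \<subseteq> (\<lambda>x. (1 + e) *\<^sub>R x) ` \<Omega> (k n) \<and> \<Omega> (k n) \<subseteq> (\<lambda>x. (1 + e) *\<^sub>R x) ` L"
        using conv e by blast
      obtain n1 where n1: "1 / real (Suc n1) < e" using e nat_approx_posE by blast
      define n where "n = max n0 n1"
      have "n1 \<le> k n" using seq_suble[OF k, of n] by (simp add: n_def)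
      then have "1 / real (Suc (k n)) \<le> 1 / real (Suc n1)" by (intro divide_left_mono) auto
      then have small: "1 / real (Suc (k n)) \<le> e" using n1 by linarith
      have "torsion_cheeger L \<le> ennreal ((1 + e) * (1 + e)) * torsion_cheeger (\<Omega> (k n))"
        by (rule torsion_cheeger_le_of_subsets[where a=0 and b=0])
          (use n0[of n] L' bodies e in \<open>auto simp: n_def pinched_body_def\<close>)
      also have "\<dots> \<le> ennreal ((1 + e) * (1 + e)) * ennreal (\<mu> + e)"
        using order_trans[OF min ennreal_leI] small by (intro mult_left_mono) auto
      also have "\<dots> = ennreal ((1 + e) * (1 + e) * (\<mu> + e))"
        using e real by (simp add: ennreal_mult)
      finally show ?thesis .
    qed
    obtain \<tau> where \<tau>: "torsion_cheeger L = ennreal \<tau>" "\<tau> \<ge> 0"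
      using bound[of 1] by (cases "torsion_cheeger L") (auto simp: top_unique)
    have "\<tau> \<le> (1 + 0) * (1 + 0) * (\<mu> + 0)"
    proof (rule tendsto_lowerbound)
      show "((\<lambda>e. (1 + e) * (1 + e) * (\<mu> + e)) \<longlongrightarrow> (1 + 0) * (1 + 0) * (\<mu> + 0)) (at_right 0)"
        by (intro tendsto_intros)
      have "\<tau> \<le> (1 + e) * (1 + e) * (\<mu> + e)" if "e > 0" for e
        using bound[OF that] that real by (simp add: \<tau> zero_le_mult_iff)
      then show "\<forall>\<^sub>F e in at_right 0. \<tau> \<le> (1 + e) * (1 + e) * (\<mu> + e)"
        by (auto simp: eventually_at intro!: exI[of _ 1])
    qed simp
    then have "torsion_cheeger L \<le> m" using \<tau> real by (simp add: ennreal_leI)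
    then show ?thesis using L' by (auto simp: \<A>_def)
  qed
  then obtain \<Omega>' where "\<Omega>' \<in> \<A>" "torsion_cheeger \<Omega>' \<le> m" by blast
  then show ?thesis
    using m_le order_trans unfolding \<A>_def by (intro exI[of _ \<Omega>']) blast
qed

end
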